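(* Let $f\in C^4(B)$ and let $\Omega$ be a compact subset of the open unit disk $\{(x,y)\in\mathbb{R}^2:x^2+y^2<1\}$. Then there is a constant $c_f$, independent of $m$ (it may depend on $f$ and $\Omega$), such that for every positive integer $m$ with $\Omega\subset\Omega_m$, $$\max_{(x,y)\in\Omega}\left|\mathcal{A}\mathcal{I}_{2m}f(x,y)-f(x,y)\right|\le c_f\,\frac{\log(m+1)}{\sqrt{m}}.$$ In particular, $\mathcal{A}\mathcal{I}_{2m}f$ converges uniformly to $f$ on any compact subset of the open unit disk as $m\to\infty$.
   Context: $B=\{(x,y)\in\mathbb{R}^2:x^2+y^2\le 1\}$ is the closed unit disk; $C^4(B)$ is the space of functions having continuous partial derivatives up to order four on $B$. The set $\Omega_m$ is $\{(x,y):\sqrt{x^2+y^2}\le\cos\frac{\pi}{2m+1}\}$. The Radon projection of $f\in C(B)$ is the line integral (with respect to arc length) $$\mathcal{R}f(\theta,t)=\int_{I(\theta,t)}f\,ds,\qquad I(\theta,t)=\{(x,y):x\cos\theta+y\sin\theta=t\}\cap B,\quad 0\le\theta\le 2\pi,\ -1\le t\le 1.$$ For an integer $m\ge1$ put $\phi_\nu=\frac{2\pi\nu}{2m+1}$ ($0\le\nu\le 2m$), $\psi_j=\frac{(2j+1)\pi}{4m+2}$ ($0\le j\le 2m$), and $\xi_l=\frac{(l+1)\pi}{2m+1}$ ($0\le l\le 2m-1$). Define $$S_{k,\nu}=\frac{k+1}{(2m+1)^2}\sum_{j=0}^{2m}\mathcal{R}f(\phi_\nu,\cos\psi_j)\,\sin((k+1)\psi_j),\qquad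 \alpha_{l,\nu}=\sum_{k=0}^{2m}S_{k,\nu}\sin((k+1)\xi_l).$$ Let $\ell_\nu$ be the piecewise linear interpolant of these values: for $\xi_l\le\theta\le\xi_{l+1}$, $$\ell_\nu(\theta)=u_\nu(\theta)\,\alpha_{l+1,\nu}+(1-u_\nu(\theta))\,\alpha_{l,\nu},\qquad u_\nu(\theta)=\frac{\theta-\xi_l}{\xi_{l+1}-\xi_l}.$$ With $\theta_\nu(x,y)=\arccos(x\cos\phi_\nu+y\sin\phi_\nu)$, the operator (OPED algorithm with linear interpolation) is $$\mathcal{A}\mathcal{I}_{2m}f(x,y)=\sum_{\nu=0}^{2m}\frac{1}{\sin\theta_\nu(x,y)}\,\ell_\nu(\theta_\nu(x,y)),$$ which is well defined for $(x,y)\in\Omega_m$, since then $\theta_\nu(x,y)\in[\xi_0,\xi_{2m-1}]$. Every compact subset of the open unit disk is contained in $\Omega_m$ for all sufficiently large $m$. *)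

theory Defs
  imports "HOL-Analysis.Analysis"
begin

definition disk :: "(real \<times> real) set" where
  "disk = {(x, y). x\<^sup>2 + y\<^sup>2 \<le> 1}"

definition open_disk :: "(real \<times> real) set" where
  "open_disk = {(x, y). x\<^sup>2 + y\<^sup>2 < 1}"

text \<open>
  \<open>C_disk n f\<close> says that \<open>f \<in> C^n(B)\<close>: all iterated partial derivatives of order up to \<open>n\<close> exist in
  the open disk and extend continuously to the closed disk. The witnesses \<open>g\<close> and \<open>h\<close> are the
  partial derivatives with respect to the first and the second variable; on the boundary circle
  they are the continuous extensions.
\<close>

primrec C_disk :: "nat \<Rightarrow> (real \<times> real \<Rightarrow> real) \<Rightarrow> bool" where
  "C_disk 0 f \<longleftrightarrow> continuous_on disk f"
| "C_disk (Suc n) f \<longleftrightarrow> continuous_on disk f \<and>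
     (\<exists>g h. C_disk n g \<and> C_disk n h \<and>
        (\<forall>(x, y)\<in>open_disk.
           ((\<lambda>s. f (s, y)) has_real_derivative g (x, y)) (at x) \<and>
           ((\<lambda>t. f (x, t)) has_real_derivative h (x, y)) (at y)))"

definition Omega :: "nat \<Rightarrow> (real \<times> real) set" where
  "Omega m = {(x, y). sqrt (x\<^sup>2 + y\<^sup>2) \<le> cos (pi / (2 * real m + 1))}"

definition chord :: "real \<Rightarrow> real \<Rightarrow> (real \<times> real) set" where
  "chord \<theta> t = {(x, y). x * cos \<theta> + y * sin \<theta> = t} \<inter> disk"

text \<open>Unit-speed parametrization of the line \<open>x cos \<theta> + y sin \<theta> = t\<close>.\<close>

definition line_point :: "real \<Rightarrow> real \<Rightarrow> real \<Rightarrow> real \<times> real" where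
  "line_point \<theta> t s = (t * cos \<theta> - s * sin \<theta>, t * sin \<theta> + s * cos \<theta>)"

definition radon :: "(real \<times> real \<Rightarrow> real) \<Rightarrow> real \<Rightarrow> real \<Rightarrow> real" where
  "radon f \<theta> t = integral (line_point \<theta> t -` chord \<theta> t) (\<lambda>s. f (line_point \<theta> t s))"

definition phi :: "nat \<Rightarrow> nat \<Rightarrow> real" where
  "phi m \<nu> = 2 * pi * real \<nu> / (2 * real m + 1)"

definition psi :: "nat \<Rightarrow> nat \<Rightarrow> real" where
  "psi m j = (2 * real j + 1) * pi / (4 * real m + 2)"

definition xi :: "nat \<Rightarrow> nat \<Rightarrow> real" where
  "xi m l = (real l + 1) * pi / (2 * real m + 1)"

definition S_coeff :: "nat \<Rightarrow> (real \<times> real \<Rightarrow> real) \<Rightarrow> nat \<Rightarrow> nat \<Rightarrow> real" where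
  "S_coeff m f k \<nu> = (real k + 1) / (2 * real m + 1)\<^sup>2 *
     (\<Sum>j = 0..2 * m. radon f (phi m \<nu>) (cos (psi m j)) * sin ((real k + 1) * psi m j))"

definition alpha :: "nat \<Rightarrow> (real \<times> real \<Rightarrow> real) \<Rightarrow> nat \<Rightarrow> nat \<Rightarrow> real" where
  "alpha m f l \<nu> = (\<Sum>k = 0..2 * m. S_coeff m f k \<nu> * sin ((real k + 1) * xi m l))"

text \<open>
  Below, \<open>l\<close> is the index of a subinterval \<open>[\<xi>\<^sub>l, \<xi>\<^sub>l\<^sub>+\<^sub>1]\<close>, \<open>0 \<le> l \<le> 2m-2\<close>, containing \<open>\<theta>\<close>. At an interior
  node there are two such indices, which give the same value (\<open>ell_eq\<close>). For \<open>\<theta>\<close> outside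
  \<open>[\<xi>\<^sub>0, \<xi>\<^sub>2\<^sub>m\<^sub>-\<^sub>1]\<close> the value is unspecified.
\<close>

definition ell :: "nat \<Rightarrow> (real \<times> real \<Rightarrow> real) \<Rightarrow> nat \<Rightarrow> real \<Rightarrow> real" where
  "ell m f \<nu> \<theta> =
     (let l = (SOME l. Suc l \<le> 2 * m - 1 \<and> xi m l \<le> \<theta> \<and> \<theta> \<le> xi m (Suc l));
          u = (\<theta> - xi m l) / (xi m (Suc l) - xi m l)
      in u * alpha m f (Suc l) \<nu> + (1 - u) * alpha m f l \<nu>)"

definition theta :: "nat \<Rightarrow> nat \<Rightarrow> real \<times> real \<Rightarrow> real" where
  "theta m \<nu> p = arccos (fst p * cos (phi m \<nu>) + snd p * sin (phi m \<nu>))"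

definition oped_interp :: "nat \<Rightarrow> (real \<times> real \<Rightarrow> real) \<Rightarrow> real \<times> real \<Rightarrow> real" where
  "oped_interp m f p = (\<Sum>\<nu> = 0..2 * m. 1 / sin (theta m \<nu> p) * ell m f \<nu> (theta m \<nu> p))"

lemma xi_less_iff: "xi m k < xi m l \<longleftrightarrow> k < l"
  by (simp add: xi_def divide_less_cancel)

lemma xi_le_iff: "xi m k \<le> xi m l \<longleftrightarrow> k \<le> l"
  by (simp add: xi_def divide_le_cancel add_nonneg_pos not_less)

lemma ell_eq:
  assumes l: "Suc l \<le> 2 * m - 1" "xi m l \<le> \<theta>" "\<theta> \<le> xi m (Suc l)"
  shows "ell m f \<nu> \<theta> =
    (\<theta> - xi m l) / (xi m (Suc l) - xi m l) * alpha m f (Suc l) \<nu> +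
    (1 - (\<theta> - xi m l) / (xi m (Suc l) - xi m l)) * alpha m f l \<nu>"
proof -
  let ?P = "\<lambda>l. Suc l \<le> 2 * m - 1 \<and> xi m l \<le> \<theta> \<and> \<theta> \<le> xi m (Suc l)"
  define k where "k = (SOME l. ?P l)"
  have k: "?P k"
    unfolding k_def by (rule someI[of ?P l]) (use l in blast)
  have "xi m k \<le> xi m (Suc l)" "xi m l \<le> xi m (Suc k)"
    using k l by linarith+
  then have "k \<le> Suc l" "l \<le> Suc k"
    by (simp_all only: xi_le_iff)
  then consider "k = l" | "k = Suc l" | "l = Suc k"
    by linarith
  then show ?thesis
  proof cases
    case 1
    then show ?thesis unfolding ell_def k_def[symmetric] Let_def by simp
  next
    case 2
    with k l have "\<theta> = xi m (Suc l)" by simp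
    moreover have "xi m l < xi m (Suc l)" "xi m (Suc l) < xi m (Suc (Suc l))"
      by (simp_all add: xi_less_iff)
    ultimately show ?thesis unfolding ell_def k_def[symmetric] Let_def 2 by simp
  next
    case 3
    with k l have "\<theta> = xi m (Suc k)" by simp
    moreover have "xi m k < xi m (Suc k)" "xi m (Suc k) < xi m (Suc (Suc k))"
      by (simp_all add: xi_less_iff)
    ultimately show ?thesis unfolding ell_def k_def[symmetric] Let_def 3 by simp
  qed
qed

lemma theta_mem_Omega:
  assumes "m \<ge> 1" "p \<in> Omega m"
  shows "theta m \<nu> p \<in> {xi m 0..xi m (2 * m - 1)}"
proof -
  obtain x y where p: "p = (x, y)" by (cases p)
  define c where "c = pi / (2 * real m + 1)"
  define s where "s = x * cos (phi m \<nu>) + y * sin (phi m \<nu>)"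
  have c: "0 \<le> c" "c \<le> pi"
    using assms by (simp_all add: c_def divide_le_eq)
  have "\<bar>(x, y) \<bullet> (cos (phi m \<nu>), sin (phi m \<nu>))\<bar> \<le>
      norm (x, y) * norm (cos (phi m \<nu>), sin (phi m \<nu>))"
    by (rule Cauchy_Schwarz_ineq2)
  then have "\<bar>s\<bar> \<le> sqrt (x\<^sup>2 + y\<^sup>2)"
    by (simp add: s_def norm_Pair)
  also have "\<dots> \<le> cos c"
    using assms by (simp add: Omega_def p c_def)
  finally have s: "\<bar>s\<bar> \<le> cos c" .
  have "cos c \<le> 1" by simp
  have "arccos s \<le> arccos (- cos c)"
    by (rule arccos_le_arccos) (use s \<open>cos c \<le> 1\<close> in linarith)+
  moreover have "arccos (cos c) \<le> arccos s"
    by (rule arccos_le_arccos) (use s \<open>cos c \<le> 1\<close> in linarith)+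
  moreover have "arccos (cos c) = c"
    using c by (rule arccos_cos)
  moreover have "arccos (- cos c) = pi - c"
    using c arccos_cos[of "pi - c"] by simp
  moreover have "xi m 0 = c"
    by (simp add: xi_def c_def)
  moreover have "xi m (2 * m - 1) = pi - c"
    using assms by (simp add: xi_def c_def of_nat_diff field_simps)
  ultimately show ?thesis
    by (simp add: theta_def p s_def)
qed

end

theory Submission
  imports Defs
begin

text \<open>
  Write \<open>N = 2m + 1\<close>, let \<open>U\<^sub>n\<close> be the Chebyshev polynomial of the second kind and let
  \<open>coord \<phi> p\<close> be the coordinate of \<open>p\<close> in direction \<open>\<phi>\<close>. Two facts carry the proof.

  First, for fixed \<open>\<phi>\<close> the odd \<open>2\<pi>\<close>-periodic extension of \<open>\<psi> \<mapsto> \<R>f(\<phi>, cos \<psi>)\<close> has sine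
  coefficients \<open>b\<^sub>n(\<phi>)\<close> (\<open>radon_coeff\<close>) that are \<open>O((n + 1)\<^sup>-\<^sup>4)\<close> uniformly in \<open>\<phi>\<close>
  (\<open>C_disk_radon_coeff_decay\<close>). The chord through \<open>cos \<psi>\<close> is the image of \<open>[-1, 1]\<close> under
  \<open>s \<mapsto> (cos \<psi>, s sin \<psi>)\<close> in rotated coordinates. This is smooth in \<open>\<psi>\<close> for each \<open>s\<close> and
  stays in the disk, so integrating by parts four times in \<open>\<psi>\<close> gives the bound.

  Second, there is a discrete inversion formula: uniformly on the disk \<open>f = \<Sum>\<^sub>n P\<^sub>n\<close>
  (\<open>radon_expansion\<close>), where for every \<open>m\<close> with \<open>n \<le> 2m\<close>
  \<open>P\<^sub>n(p) = (n + 1)/(2N) \<Sum>\<^sub>\<nu> b\<^sub>n(\<phi>\<^sub>\<nu>) U\<^sub>n(coord \<phi>\<^sub>\<nu> p)\<close>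
  (\<open>radon_proj_discrete\<close>). It rests on the ridge functions \<open>U\<^sub>n(coord \<eta> p)\<close>. As functions of
  \<open>\<eta>\<close> they are trigonometric polynomials with frequencies of the parity of \<open>n\<close>, which \<open>N\<close>
  equally spaced angles reproduce exactly (\<open>ridge_reproducing\<close>). Their chord integrals are
  explicit (\<open>chord_int_ridge\<close>). They span a dense subspace of \<open>C(B)\<close> (\<open>ridge_total\<close>). Hence a
  linear, sup-norm continuous functional on \<open>C(B)\<close> is determined by its values on ridge functions. This
  shows both that the disk integral is rotation invariant, from which \<open>b\<^sub>n\<close> inherits the
  reproducing property of the ridge functions, and that a continuous function with vanishing
  coefficients is zero. The series \<open>\<Sum>\<^sub>n P\<^sub>n\<close> converges uniformly and has the coefficients of \<open>f\<close>,
  so its sum is \<open>f\<close>.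

  The algorithm differs from the partial sum \<open>\<Sum>\<^sub>k\<^sub>\<le>\<^sub>2\<^sub>m P\<^sub>k(p)\<close> in two respects: \<open>b\<^sub>k(\<phi>\<^sub>\<nu>)\<close> is
  replaced by a discrete sine coefficient, an error \<open>O(N\<^sup>-\<^sup>3)\<close> by aliasing, and a sine polynomial
  with Lipschitz constant \<open>O(1/N)\<close> is interpolated on a grid of step \<open>\<pi>/N\<close>. On a compact subset
  of the open disk the factors \<open>1/sin \<theta>\<^sub>\<nu>\<close> are bounded, so after summing over the \<open>N\<close> angles both
  errors are \<open>O(1/N)\<close>, and so is the tail of \<open>\<Sum>\<^sub>k P\<^sub>k\<close>. The resulting rate \<open>O(1/m)\<close> implies the
  stated one.
\<close>

section \<open>Chebyshev polynomials\<close>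

fun cheb_T :: "nat \<Rightarrow> real \<Rightarrow> real" where
  "cheb_T 0 t = 1"
| "cheb_T (Suc 0) t = t"
| "cheb_T (Suc (Suc n)) t = 2 * t * cheb_T (Suc n) t - cheb_T n t"

fun cheb_U :: "nat \<Rightarrow> real \<Rightarrow> real" where
  "cheb_U 0 t = 1"
| "cheb_U (Suc 0) t = 2 * t"
| "cheb_U (Suc (Suc n)) t = 2 * t * cheb_U (Suc n) t - cheb_U n t"

lemma cheb_T_cos: "cheb_T n (cos x) = cos (real n * x)"
proof (induction n "cos x" rule: cheb_T.induct)
  case (3 n)
  have "cos (real (Suc (Suc n)) * x) + cos (real n * x) = 2 * cos x * cos (real (Suc n) * x)"
    by (simp add: cos_plus_cos algebra_simps add_divide_distrib diff_divide_distrib)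
  with 3 show ?case by simp
qed simp_all

lemma sin_mult_cheb_U: "sin x * cheb_U n (cos x) = sin ((real n + 1) * x)"
proof (induction n "cos x" rule: cheb_U.induct)
  case (3 n)
  have "sin ((real (Suc (Suc n)) + 1) * x) + sin ((real n + 1) * x)
      = 2 * cos x * sin ((real (Suc n) + 1) * x)"
    by (simp add: sin_plus_sin algebra_simps add_divide_distrib diff_divide_distrib)
  with 3 show ?case by (simp add: algebra_simps)
qed (simp_all add: sin_double)

lemma cheb_U_Suc: "cheb_U (Suc n) t = t * cheb_U n t + cheb_T (Suc n) t"
proof (induction n t rule: cheb_U.induct)
  case (3 n t)
  define u0 u1 u2 where "u0 = cheb_U n t" and "u1 = cheb_U (Suc n) t" and "u2 = cheb_U (Suc (Suc n)) t"
  define t1 t2 where "t1 = cheb_T (Suc n) t" and "t2 = cheb_T (Suc (Suc n)) t"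
  have "u2 = 2 * t * u1 - u0" "u2 = t * u1 + t2" "u1 = t * u0 + t1"
    using 3 by (simp_all only: u0_def u1_def u2_def t1_def t2_def cheb_U.simps)
  then have "2 * t * u2 - u1 = t * u2 + (2 * t * t2 - t1)"
    by algebra
  then show ?case
    by (simp only: u0_def u1_def u2_def t1_def t2_def cheb_U.simps cheb_T.simps)
qed (simp_all add: algebra_simps)

lemma abs_cheb_T_le: assumes "\<bar>t\<bar> \<le> 1" shows "\<bar>cheb_T n t\<bar> \<le> 1"
proof -
  have "t = cos (arccos t)" using assms by simp
  then show ?thesis using cheb_T_cos[of n "arccos t"] by (metis abs_cos_le_one)
qed

lemma abs_cheb_U_le: "\<bar>t\<bar> \<le> 1 \<Longrightarrow> \<bar>cheb_U n t\<bar> \<le> real n + 1"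
proof (induction n)
  case (Suc n)
  have "\<bar>t * cheb_U n t\<bar> \<le> 1 * (real n + 1)"
    unfolding abs_mult using Suc by (intro mult_mono) auto
  then show ?case using abs_cheb_T_le[OF Suc.prems, of "Suc n"] cheb_U_Suc[of n t] by simp
qed simp

lemma cheb_T_sq_eq_1: "t\<^sup>2 = 1 \<Longrightarrow> cheb_T n t = t ^ n"
  by (induction n t rule: cheb_T.induct) (simp_all add: power2_eq_square flip: mult.assoc)

lemma cheb_U_sq_eq_1: "t\<^sup>2 = 1 \<Longrightarrow> cheb_U n t = (real n + 1) * t ^ n"
  by (induction n) (simp_all add: cheb_U_Suc cheb_T_sq_eq_1 algebra_simps)

lemma continuous_on_cheb_U [continuous_intros]:
  fixes g :: "'a::topological_space \<Rightarrow> real"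
  assumes "continuous_on S g"
  shows "continuous_on S (\<lambda>x. cheb_U n (g x))"
proof -
  have "continuous_on UNIV (cheb_U n)"
    by (induction n rule: cheb_U.induct[of "\<lambda>n _. continuous_on UNIV (cheb_U n)"])
       (auto intro!: continuous_intros)
  then show ?thesis using assms continuous_on_compose2 by blast
qed

lemma DERIV_cheb_T:
  "(cheb_T (Suc n) has_real_derivative (real n + 1) * cheb_U n t) (at t)"
proof (induction n t rule: cheb_U.induct)
  case (1 t) then show ?case by (simp add: DERIV_ident fun_eq_iff)
next
  case (2 t)
  have "((\<lambda>t. 2 * t * t - 1) has_real_derivative 4 * t) (at t)"
    by (auto intro!: derivative_eq_intros)
  then show ?case by (simp add: fun_eq_iff mult.assoc)
next
  case (3 n t)
  have "((\<lambda>t. 2 * t * cheb_T (Suc (Suc n)) t - cheb_T (Suc n) t) has_real_derivative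
     (2 * cheb_T (Suc (Suc n)) t + 2 * t * ((real (Suc n) + 1) * cheb_U (Suc n) t) -
     (real n + 1) * cheb_U n t)) (at t)"
    using 3 by (auto intro!: derivative_eq_intros simp del: cheb_T.simps cheb_U.simps)
  moreover have "cheb_T (Suc (Suc n)) t = t * cheb_U (Suc n) t - cheb_U n t"
    using cheb_U_Suc[of "Suc n" t] by simp
  then have "2 * cheb_T (Suc (Suc n)) t + 2 * t * ((real (Suc n) + 1) * cheb_U (Suc n) t) -
     (real n + 1) * cheb_U n t = (real (Suc (Suc n)) + 1) * cheb_U (Suc (Suc n)) t"
    by (simp add: algebra_simps del: cheb_T.simps)
  ultimately show ?case
    by (simp only: cheb_T.simps(3)[abs_def])
qed

section \<open>Ridge functions and equally spaced angles\<close>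

definition coord :: "real \<Rightarrow> real \<times> real \<Rightarrow> real" where
  "coord \<phi> p = fst p * cos \<phi> + snd p * sin \<phi>"

lemma continuous_on_coord [continuous_intros]:
  fixes S :: "'a::t2_space set"
  shows "continuous_on S g \<Longrightarrow> continuous_on S h \<Longrightarrow> continuous_on S (\<lambda>x. coord (g x) (h x))"
  unfolding coord_def by (auto intro!: continuous_intros)

lemma coord_line_point: "coord \<eta> (line_point \<phi> t s) = t * cos (\<eta> - \<phi>) + s * sin (\<eta> - \<phi>)"
  by (simp add: coord_def line_point_def cos_diff sin_diff algebra_simps)

lemma abs_coord_le: "\<bar>coord \<phi> p\<bar> \<le> sqrt ((fst p)\<^sup>2 + (snd p)\<^sup>2)"
proof -
  have "\<bar>p \<bullet> (cos \<phi>, sin \<phi>)\<bar> \<le> norm p * norm (cos \<phi>, sin \<phi>)"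
    by (rule Cauchy_Schwarz_ineq2)
  then show ?thesis by (simp add: coord_def inner_prod_def norm_prod_def)
qed

lemma abs_coord_le_1: "p \<in> disk \<Longrightarrow> \<bar>coord \<phi> p\<bar> \<le> 1"
  using abs_coord_le[of \<phi> p] by (auto simp: disk_def intro: order_trans)

text \<open>
  Trigonometric polynomials of degree at most \<open>n\<close> whose frequencies have the parity of \<open>n\<close>. The
  parity matters because the product of two members has only even frequencies, up to \<open>2n\<close>; these
  are integrated exactly by \<open>2m + 1\<close> equally spaced nodes already for \<open>n \<le> 2m\<close>, twice the range
  that degree alone would allow.
\<close>

inductive_set trig_space :: "nat \<Rightarrow> (real \<Rightarrow> complex) set" for n where
  wave: "\<bar>i\<bar> \<le> int n \<Longrightarrow> even (int n - i) \<Longrightarrow> (\<lambda>\<phi>. c * cis (real_of_int i * \<phi>)) \<in> trig_space n"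
| add: "a \<in> trig_space n \<Longrightarrow> b \<in> trig_space n \<Longrightarrow> (\<lambda>\<phi>. a \<phi> + b \<phi>) \<in> trig_space n"

lemma trig_space_scale: "a \<in> trig_space n \<Longrightarrow> (\<lambda>\<phi>. c * a \<phi>) \<in> trig_space n"
proof (induction rule: trig_space.induct)
  case (wave i d)
  then show ?case using trig_space.wave[of i n "c * d"] by (simp add: mult.assoc)
qed (simp add: distrib_left trig_space.add)

lemma trig_space_Suc_Suc: "a \<in> trig_space n \<Longrightarrow> a \<in> trig_space (Suc (Suc n))"
  by (induction rule: trig_space.induct) (auto intro!: trig_space.intros)

lemma trig_space_coord:
  "a \<in> trig_space n \<Longrightarrow> (\<lambda>\<phi>. 2 * of_real (coord \<phi> p) * a \<phi>) \<in> trig_space (Suc n)"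
proof (induction rule: trig_space.induct)
  case (wave i c)
  define w where "w = Complex (fst p) (snd p)"
  have 1: "2 * of_real (coord \<phi> p) * (c * cis (i * \<phi>))
    = (c * cnj w) * cis (of_int (i + 1) * \<phi>) + (c * w) * cis (of_int (i - 1) * \<phi>)" for \<phi> :: real
  proof -
    have "2 * of_real (coord \<phi> p) = cnj w * cis \<phi> + w * cis (- \<phi>)"
      by (simp add: w_def coord_def complex_eq_iff)
    then show ?thesis by (simp add: algebra_simps cis_mult)
  qed
  have "(\<lambda>\<phi>. (c * cnj w) * cis (of_int (i + 1) * \<phi>) + (c * w) * cis (of_int (i - 1) * \<phi>))
      \<in> trig_space (Suc n)"
    by (intro trig_space.add trig_space.wave) (use wave in auto)
  then show ?case by (simp only: 1)
next
  case (add a b)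
  then show ?case by (simp add: distrib_left trig_space.add)
qed

lemma cheb_U_ridge_in_trig_space: "(\<lambda>\<phi>. of_real (cheb_U n (coord \<phi> p))) \<in> trig_space n"
proof (induction n rule: cheb_U.induct[of "\<lambda>n _. (\<lambda>\<phi>. of_real (cheb_U n (coord \<phi> p))) \<in> trig_space n"])
  case 1
  show ?case using trig_space.wave[of 0 0 1] by simp
next
  case 2
  show ?case using trig_space_coord[OF trig_space.wave[of 0 0 1]] by simp
next
  case (3 n)
  show ?case
    using trig_space.add[OF trig_space_coord[OF 3(1), of p]
        trig_space_scale[OF trig_space_Suc_Suc[OF 3(2)], of "-1"]]
    by simp
qed

text \<open>
  The Dirichlet-type kernel of \<open>trig_space n\<close>: each admissible frequency occurs exactly once.
\<close>

lemma cheb_U_cos_eq_sum_cis: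
  "of_real (cheb_U n (cos \<tau>)) = (\<Sum>j\<le>n. cis (of_int (int n - 2 * int j) * \<tau>))"
proof (induction n rule: cheb_U.induct[of "\<lambda>n _. of_real (cheb_U n (cos \<tau>)) = (\<Sum>j\<le>n. cis (of_int (int n - 2 * int j) * \<tau>))"])
  case (3 n)
  have c: "2 * complex_of_real (cos \<tau>) = cis \<tau> + cis (- \<tau>)" by (simp add: complex_eq_iff)
  have "of_real (cheb_U (Suc (Suc n)) (cos \<tau>)) = (\<Sum>j\<le>Suc n. cis (of_int (int (Suc (Suc n)) - 2 * int j) * \<tau>))
     + (\<Sum>j\<le>Suc n. cis (of_int (int n - 2 * int j) * \<tau>)) - (\<Sum>j\<le>n. cis (of_int (int n - 2 * int j) * \<tau>))"
  proof -
    have "of_real (cheb_U (Suc (Suc n)) (cos \<tau>)) = (2 * complex_of_real (cos \<tau>)) * of_real (cheb_U (Suc n) (cos \<tau>))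
      - of_real (cheb_U n (cos \<tau>))" by simp
    also have "\<dots> = (cis \<tau> + cis (- \<tau>)) * (\<Sum>j\<le>Suc n. cis (of_int (int (Suc n) - 2 * int j) * \<tau>))
      - (\<Sum>j\<le>n. cis (of_int (int n - 2 * int j) * \<tau>))"
      unfolding c 3 ..
    also have "(cis \<tau> + cis (- \<tau>)) * (\<Sum>j\<le>Suc n. cis (of_int (int (Suc n) - 2 * int j) * \<tau>))
      = (\<Sum>j\<le>Suc n. cis (of_int (int (Suc (Suc n)) - 2 * int j) * \<tau>))
        + (\<Sum>j\<le>Suc n. cis (of_int (int n - 2 * int j) * \<tau>))"
      unfolding sum_distrib_left distrib_right cis_mult sum.distrib
      by (intro arg_cong2[where f = "(+)"] sum.cong arg_cong[where f = cis]) (simp_all add: algebra_simps)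
    finally show ?thesis .
  qed
  also have "\<dots> = (\<Sum>j\<le>Suc n. cis (of_int (int (Suc (Suc n)) - 2 * int j) * \<tau>))
     + cis (of_int (int n - 2 * int (Suc n)) * \<tau>)"
    unfolding sum.atMost_Suc[of "\<lambda>j. cis (of_int (int n - 2 * int j) * \<tau>)" n] by simp
  also have "\<dots> = (\<Sum>j\<le>Suc (Suc n). cis (of_int (int (Suc (Suc n)) - 2 * int j) * \<tau>))"
    by (simp add: sum.atMost_Suc[of _ "Suc n"] minus_diff_commute del: sum.atMost_Suc)
  finally show ?case .
qed (simp_all add: complex_eq_iff)

text \<open>
  A geometric sum of roots of unity of order \<open>2m + 1\<close>. As this order is odd, it divides the even
  number \<open>p\<close> only if \<open>2 (2m + 1)\<close> does, which the bound on \<open>\<bar>p\<bar>\<close> excludes.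
\<close>

lemma sum_cis_phi_eq_0:
  assumes "even p" "p \<noteq> 0" "\<bar>p\<bar> \<le> 4 * int m"
  shows "(\<Sum>\<nu>=0..2*m. cis (of_int p * phi m \<nu>)) = 0"
proof -
  define z where "z = cis (of_int p * (2 * pi / (2 * real m + 1)))"
  have pow: "cis (of_int p * phi m \<nu>) = z ^ \<nu>" for \<nu>
    unfolding z_def phi_def Complex.DeMoivre by (simp add: algebra_simps)
  have "z \<noteq> 1"
  proof
    assume "z = 1"
    then have "cos (of_int p * (2 * pi / (2 * real m + 1))) = 1"
      unfolding z_def by (simp add: complex_eq_iff)
    then obtain k :: int where "of_int p * (2 * pi / (2 * real m + 1)) = of_int k * 2 * pi"
      using cos_one_2pi_int by blast
    then have "pi * of_int p = pi * (of_int k * (2 * real m + 1))"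
      by (simp add: field_simps)
    then have "of_int p = of_int k * (2 * real m + 1)"
      by (simp only: mult_cancel_left pi_neq_zero) simp
    then have "real_of_int p = real_of_int (k * (2 * int m + 1))"
      by simp
    then have pk: "p = k * (2 * int m + 1)"
      by (simp only: of_int_eq_iff)
    with assms have "even k" "k \<noteq> 0" by auto
    then have "\<bar>k\<bar> \<ge> 2" by presburger
    then have "\<bar>p\<bar> \<ge> 2 * (2 * int m + 1)"
      unfolding pk abs_mult by (intro mult_mono) auto
    with assms show False by simp
  qed
  moreover have "z ^ Suc (2 * m) = 1"
  proof -
    have "z ^ Suc (2 * m) = cis (2 * pi * of_int p)"
      unfolding z_def Complex.DeMoivre
      by (rule arg_cong[where f = cis]) (simp add: field_simps)
    then show ?thesis by (simp add: cis_multiple_2pi)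
  qed
  moreover have "(\<Sum>\<nu>=0..2*m. cis (of_int p * phi m \<nu>)) = (\<Sum>\<nu><Suc (2*m). z ^ \<nu>)"
    unfolding pow by (intro sum.cong) auto
  ultimately show ?thesis using geometric_sum[of z "Suc (2 * m)"] by (simp only: diff_self div_0 simp_thms)
qed

text \<open>
  The kernel \<open>U\<^sub>n(cos(\<phi> - \<eta>))\<close> contains every admissible frequency once, so pairing it with the
  wave of frequency \<open>i\<close> leaves only the term of frequency \<open>-i\<close> after summation over the nodes.
\<close>

lemma trig_space_reproducing:
  assumes "n \<le> 2 * m" "a \<in> trig_space n"
  shows "(\<Sum>\<nu>=0..2*m. a (phi m \<nu>) * of_real (cheb_U n (cos (phi m \<nu> - \<eta>)))) = (2 * of_nat m + 1) * a \<eta>"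
  using assms(2)
proof (induction rule: trig_space.induct)
  case (wave i c)
  obtain h where h: "int n + i = 2 * h" using wave(2) by (metis even_add even_diff evenE)
  define j0 where "j0 = nat h"
  have h0: "0 \<le> h" "h \<le> int n" using h wave(1) by linarith+
  have sm: "(\<Sum>\<nu>=0..2*m. cis (of_int (i + int n - 2 * int j) * phi m \<nu>)) = (if j = j0 then 2 * of_nat m + 1 else 0)"
    if "j \<le> n" for j
  proof (cases "j = j0")
    case True
    then have "i + int n - 2 * int j = 0" using h h0 by (simp add: j0_def)
    then show ?thesis using True by simp
  next
    case False
    have "i + int n - 2 * int j = 2 * (h - int j)" using h by simp
    moreover have "h \<noteq> int j" using False by (auto simp: j0_def)
    ultimately show ?thesis
      using False sum_cis_phi_eq_0[of "i + int n - 2 * int j" m] h0 that assms(1) by simp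
  qed
  have "(\<Sum>\<nu>=0..2*m. c * cis (i * phi m \<nu>) * of_real (cheb_U n (cos (phi m \<nu> - \<eta>))))
     = (\<Sum>\<nu>=0..2*m. \<Sum>j\<le>n. c * cis (- of_int (int n - 2 * int j) * \<eta>) * cis (of_int (i + int n - 2 * int j) * phi m \<nu>))"
    unfolding cheb_U_cos_eq_sum_cis sum_distrib_left mult.assoc cis_mult
    by (intro sum.cong refl arg_cong[where f = "\<lambda>x. c * cis x"]) (simp add: algebra_simps)
  also have "\<dots> = (\<Sum>j\<le>n. c * cis (- of_int (int n - 2 * int j) * \<eta>) * (if j = j0 then 2 * of_nat m + 1 else 0))"
    by (subst sum.swap, intro sum.cong refl) (simp only: sum_distrib_left[symmetric] sm atMost_iff)
  also have "\<dots> = c * cis (- of_int (int n - 2 * int j0) * \<eta>) * (2 * of_nat m + 1)"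
    using h0 by (simp add: sum.delta if_distrib j0_def cong: if_cong)
  also have "- (int n - 2 * int j0) = i" using h h0 by (simp add: j0_def)
  then have "- real_of_int (int n - 2 * int j0) = of_int i" by (metis of_int_minus)
  finally show ?case by simp
qed (simp add: algebra_simps sum.distrib)

lemma ridge_reproducing:
  assumes "n \<le> 2 * m"
  shows "(\<Sum>\<nu>=0..2*m. cheb_U n (coord (phi m \<nu>) p) * cheb_U n (cos (phi m \<nu> - \<eta>)))
    = (2 * real m + 1) * cheb_U n (coord \<eta> p)"
proof -
  have "complex_of_real (\<Sum>\<nu>=0..2*m. cheb_U n (coord (phi m \<nu>) p) * cheb_U n (cos (phi m \<nu> - \<eta>)))
    = complex_of_real ((2 * real m + 1) * cheb_U n (coord \<eta> p))"
    using trig_space_reproducing[OF assms cheb_U_ridge_in_trig_space[of n p], of \<eta>] by simp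
  then show ?thesis by (simp only: of_real_eq_iff)
qed

section \<open>Functionals determined by ridge functions\<close>

lemma disk_eq_cball: "disk = cball 0 1"
  by (auto simp: disk_def dist_norm norm_prod_def real_sqrt_le_1_iff)

lemma compact_disk: "compact disk"
  by (simp add: disk_eq_cball)

text \<open>
  Continuous linear functionals on \<open>C(B)\<close> with the sup norm, realised as functionals on all
  functions that have the required properties on those continuous on the disk.
\<close>

definition sup_functional :: "((real \<times> real \<Rightarrow> real) \<Rightarrow> real) \<Rightarrow> bool" where
  "sup_functional L \<longleftrightarrow>
     (\<forall>F G. continuous_on disk F \<longrightarrow> continuous_on disk G \<longrightarrow> L (\<lambda>x. F x + G x) = L F + L G) \<and>
     (\<forall>c F. continuous_on disk F \<longrightarrow> L (\<lambda>x. c * F x) = c * L F) \<and>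
     (\<exists>C\<ge>0. \<forall>F e. continuous_on disk F \<longrightarrow> (\<forall>x\<in>disk. \<bar>F x\<bar> \<le> e) \<longrightarrow> \<bar>L F\<bar> \<le> C * e)"

lemma sup_functionalI:
  assumes "\<And>F G. continuous_on disk F \<Longrightarrow> continuous_on disk G \<Longrightarrow> L (\<lambda>x. F x + G x) = L F + L G"
    and "\<And>c F. continuous_on disk F \<Longrightarrow> L (\<lambda>x. c * F x) = c * L F"
    and "C \<ge> 0"
    and "\<And>F e. continuous_on disk F \<Longrightarrow> (\<And>x. x \<in> disk \<Longrightarrow> \<bar>F x\<bar> \<le> e) \<Longrightarrow> \<bar>L F\<bar> \<le> C * e"
  shows "sup_functional L"
  unfolding sup_functional_def using assms by blast

text \<open>
  The span of plane waves is a point-separating algebra, by the product-to-sum formula for the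
  cosine, and each plane wave is a function of one coordinate. It links ridge functions to the
  Stone-Weierstrass theorem.
\<close>

inductive_set wave_span :: "(real \<times> real \<Rightarrow> real) set" where
  wave: "(\<lambda>x. a * cos (u * fst x + v * snd x + c)) \<in> wave_span"
| add: "F \<in> wave_span \<Longrightarrow> G \<in> wave_span \<Longrightarrow> (\<lambda>x. F x + G x) \<in> wave_span"

lemma continuous_on_wave_span: "F \<in> wave_span \<Longrightarrow> continuous_on S F"
  by (induction rule: wave_span.induct) (auto intro!: continuous_intros)

lemma wave_span_mult_wave:
  "G \<in> wave_span \<Longrightarrow> (\<lambda>x. (a * cos (u * fst x + v * snd x + c)) * G x) \<in> wave_span"
proof (induction rule: wave_span.induct)
  case (wave a' u' v' c')
  have "(\<lambda>x. (a * cos (u * fst x + v * snd x + c)) * (a' * cos (u' * fst x + v' * snd x + c')))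
    = (\<lambda>x. a * a' / 2 * cos ((u + u') * fst x + (v + v') * snd x + (c + c'))
      + a * a' / 2 * cos ((u - u') * fst x + (v - v') * snd x + (c - c')))"
  proof
    fix x :: "real \<times> real"
    define A B where "A = u * fst x + v * snd x + c" and "B = u' * fst x + v' * snd x + c'"
    have "(u + u') * fst x + (v + v') * snd x + (c + c') = A + B"
      "(u - u') * fst x + (v - v') * snd x + (c - c') = A - B"
      by (simp_all add: A_def B_def algebra_simps)
    note AB = this
    show "(a * cos (u * fst x + v * snd x + c)) * (a' * cos (u' * fst x + v' * snd x + c'))
      = a * a' / 2 * cos ((u + u') * fst x + (v + v') * snd x + (c + c'))
      + a * a' / 2 * cos ((u - u') * fst x + (v - v') * snd x + (c - c'))"
      unfolding AB A_def[symmetric] B_def[symmetric] cos_add cos_diff by (simp add: algebra_simps)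
  qed
  then show ?case by (simp only: wave_span.intros)
next
  case (add F G)
  then show ?case by (simp only: distrib_left wave_span.add)
qed

lemma wave_span_mult: "F \<in> wave_span \<Longrightarrow> G \<in> wave_span \<Longrightarrow> (\<lambda>x. F x * G x) \<in> wave_span"
  by (induction rule: wave_span.induct)
     (simp_all only: wave_span_mult_wave distrib_right wave_span.add)

context
  fixes L assumes L: "sup_functional L"
begin

lemma sup_functional_add:
  "continuous_on disk F \<Longrightarrow> continuous_on disk G \<Longrightarrow> L (\<lambda>x. F x + G x) = L F + L G"
  using L unfolding sup_functional_def by blast

lemma sup_functional_scale: "continuous_on disk F \<Longrightarrow> L (\<lambda>x. c * F x) = c * L F"
  using L unfolding sup_functional_def by blast

lemma sup_functional_bound:
  obtains C where "C \<ge> 0"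
    "\<And>F e. continuous_on disk F \<Longrightarrow> (\<And>x. x \<in> disk \<Longrightarrow> \<bar>F x\<bar> \<le> e) \<Longrightarrow> \<bar>L F\<bar> \<le> C * e"
  using L unfolding sup_functional_def by blast

lemma sup_functional_diff:
  assumes "continuous_on disk F" "continuous_on disk G"
  shows "L (\<lambda>x. F x - G x) = L F - L G"
  using sup_functional_add[OF assms(1), of "\<lambda>x. -1 * G x"] sup_functional_scale[OF assms(2), of "-1"] assms(2)
  by (simp add: continuous_on_minus)

lemma sup_functional_zero: "L (\<lambda>x. 0) = 0"
  using sup_functional_scale[of "\<lambda>x. 0" 0] by simp

lemma sup_functional_sum:
  "finite I \<Longrightarrow> (\<And>i. i \<in> I \<Longrightarrow> continuous_on disk (F i)) \<Longrightarrow> L (\<lambda>x. \<Sum>i\<in>I. F i x) = (\<Sum>i\<in>I. L (F i))"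
  by (induction rule: finite_induct)
     (simp_all add: sup_functional_zero sup_functional_add continuous_on_sum)

lemma sup_functional_LIMSEQ:
  assumes "\<And>n. continuous_on disk (F n)" "uniform_limit disk F G sequentially"
  shows "(\<lambda>n. L (F n)) \<longlonglongrightarrow> L G"
proof -
  have G: "continuous_on disk G"
    using assms by (intro uniform_limit_theorem[OF _ assms(2)]) auto
  obtain C where C: "C \<ge> 0"
    "\<And>F e. continuous_on disk F \<Longrightarrow> (\<And>x. x \<in> disk \<Longrightarrow> \<bar>F x\<bar> \<le> e) \<Longrightarrow> \<bar>L F\<bar> \<le> C * e"
    using sup_functional_bound by blast
  show ?thesis
  proof (rule tendstoI)
    fix e :: real assume e: "e > 0"
    define d where "d = e / (C + 1)"
    have d: "d > 0" "C * d < e" using e C(1) by (simp_all add: d_def field_simps)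
    show "\<forall>\<^sub>F n in sequentially. dist (L (F n)) (L G) < e"
      using uniform_limitD[OF assms(2) d(1)]
    proof eventually_elim
      case (elim n)
      have "\<bar>L (\<lambda>x. F n x - G x)\<bar> \<le> C * d"
        using elim assms(1) G by (intro C(2)) (auto intro!: continuous_intros simp: dist_real_def less_imp_le)
      then show ?case
        using d by (simp add: sup_functional_diff assms(1) G dist_real_def)
    qed
  qed
qed

lemma sup_functional_sums:
  assumes "\<And>n. continuous_on disk (F n)" "uniform_limit disk (\<lambda>N x. \<Sum>n<N. F n x) G sequentially"
  shows "(\<lambda>n. L (F n)) sums L G"
  using sup_functional_LIMSEQ[OF _ assms(2)] assms(1)
  by (simp add: sums_def sup_functional_sum continuous_on_sum)

lemma sup_functional_approx_zero:
  assumes "continuous_on disk G"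
    and "\<And>e. e > 0 \<Longrightarrow> \<exists>F. continuous_on disk F \<and> L F = 0 \<and> (\<forall>x\<in>disk. \<bar>G x - F x\<bar> \<le> e)"
  shows "L G = 0"
proof -
  obtain F where F: "\<And>n. continuous_on disk (F n)" "\<And>n. L (F n) = 0"
    "\<And>n x. x \<in> disk \<Longrightarrow> \<bar>G x - F n x\<bar> \<le> inverse (Suc n)"
    using assms(2)[of "inverse (Suc n)" for n] by (auto simp: inverse_Suc) metis
  have "uniform_limit disk F G sequentially"
  proof (rule uniform_limitI)
    fix e :: real assume "e > 0"
    then obtain k where k: "inverse (Suc k) < e" using reals_Archimedean by blast
    show "\<forall>\<^sub>F n in sequentially. \<forall>x\<in>disk. dist (F n x) (G x) < e"
      using eventually_ge_at_top[of k]
    proof eventually_elim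
      case (elim n)
      then have "inverse (real (Suc n)) \<le> inverse (Suc k)" by simp
      with k have "inverse (real (Suc n)) < e" by linarith
      then show ?case
        using F(3)[of _ n] by (auto simp: dist_real_def abs_minus_commute intro: le_less_trans)
    qed
  qed
  from sup_functional_LIMSEQ[OF F(1) this] F(2) show ?thesis
    by (simp add: LIMSEQ_const_iff)
qed

context
  assumes ridge: "\<And>n \<eta>. L (\<lambda>x. cheb_U n (coord \<eta> x)) = 0"
begin

text \<open>
  The recursion \<open>2 t U\<^sub>n = U\<^sub>n\<^sub>+\<^sub>1 + U\<^sub>n\<^sub>-\<^sub>1\<close> trades a factor \<open>t\<close> for ridge functions of neighbouring
  degree, so that all powers of a coordinate are reached without expanding them in the \<open>U\<^sub>n\<close>.
\<close>

lemma annihilates_power_mult_ridge: "L (\<lambda>x. coord \<eta> x ^ j * cheb_U n (coord \<eta> x)) = 0"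
proof (induction j arbitrary: n)
  case 0 then show ?case by (simp add: ridge)
next
  case (Suc j)
  have cont: "continuous_on disk (\<lambda>x. coord \<eta> x ^ j * cheb_U n (coord \<eta> x))" for n
    by (intro continuous_intros)
  show ?case
  proof (cases n)
    case 0
    have "(\<lambda>x. coord \<eta> x ^ Suc j * cheb_U n (coord \<eta> x)) =
        (\<lambda>x. 1/2 * (coord \<eta> x ^ j * cheb_U 1 (coord \<eta> x)))"
      by (simp add: 0 fun_eq_iff)
    then show ?thesis by (simp only: sup_functional_scale[OF cont] Suc mult_zero_right)
  next
    case (Suc k)
    have "(\<lambda>x. coord \<eta> x ^ Suc j * cheb_U n (coord \<eta> x)) =
        (\<lambda>x. 1/2 * (coord \<eta> x ^ j * cheb_U (Suc (Suc k)) (coord \<eta> x) + coord \<eta> x ^ j * cheb_U k (coord \<eta> x)))"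
      by (simp add: Suc fun_eq_iff algebra_simps)
    then show ?thesis
      using Suc.IH cont by (simp only: sup_functional_scale sup_functional_add continuous_on_add) simp
  qed
qed

lemma annihilates_continuous_ridge:
  assumes "continuous_on {-1..1} q"
  shows "L (\<lambda>x. q (coord \<eta> x)) = 0"
proof (rule sup_functional_approx_zero)
  have mem: "coord \<eta> ` disk \<subseteq> {-1..1}"
    using abs_coord_le_1[of _ \<eta>] by (force simp: abs_le_iff)
  then show "continuous_on disk (\<lambda>x. q (coord \<eta> x))"
    by (intro continuous_on_compose2[OF assms]) (auto intro!: continuous_intros)
  fix e :: real assume "e > 0"
  then obtain p where p: "real_polynomial_function p" "\<And>x. x \<in> {-1..1} \<Longrightarrow> \<bar>q x - p x\<bar> < e"
    using Stone_Weierstrass_real_polynomial_function[OF _ assms] by (metis compact_Icc)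
  obtain a n where an: "p = (\<lambda>x. \<Sum>i\<le>n. a i * x ^ i)"
    using p(1) real_polynomial_function_iff_sum by blast
  have "L (\<lambda>x. p (coord \<eta> x)) = 0"
    using annihilates_power_mult_ridge[of \<eta> _ 0]
    by (simp add: an sup_functional_sum sup_functional_scale continuous_intros)
  moreover have "continuous_on disk (\<lambda>x. p (coord \<eta> x))"
    unfolding an by (intro continuous_intros)
  ultimately show "\<exists>F. continuous_on disk F \<and> L F = 0 \<and> (\<forall>x\<in>disk. \<bar>q (coord \<eta> x) - F x\<bar> \<le> e)"
    using p(2) mem by (intro exI[of _ "\<lambda>x. p (coord \<eta> x)"]) (fastforce simp: less_imp_le)
qed

lemma annihilates_wave_span: "F \<in> wave_span \<Longrightarrow> L F = 0"
proof (induction rule: wave_span.induct)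
  case (wave a u v c)
  obtain r \<eta> where r: "u = r * cos \<eta>" "v = r * sin \<eta>"
    using polar_Ex by metis
  have "(\<lambda>x. a * cos (u * fst x + v * snd x + c)) = (\<lambda>x. (\<lambda>t. a * cos (r * t + c)) (coord \<eta> x))"
    by (simp add: r coord_def algebra_simps)
  then show ?case
    using annihilates_continuous_ridge[of "\<lambda>t. a * cos (r * t + c)" \<eta>]
    by (simp add: continuous_intros)
next
  case (add F G)
  then show ?case by (simp add: sup_functional_add continuous_on_wave_span)
qed

text \<open>
  Density of ridge functions in \<open>C(B)\<close>: polynomials in one coordinate approximate continuous
  functions of that coordinate (Weierstrass), among them plane waves, and the plane waves
  approximate every continuous function (Stone-Weierstrass).
\<close>

theorem ridge_total:
  assumes "continuous_on disk F"
  shows "L F = 0"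
proof -
  interpret function_ring_on wave_span disk
  proof
    fix c show "(\<lambda>_. c) \<in> wave_span"
      using wave_span.wave[of c 0 0 0] by simp
  next
    fix x y :: "real \<times> real" assume "x \<in> disk" "y \<in> disk" "x \<noteq> y"
    define u v where "u = fst y - fst x" and "v = snd y - snd x"
    have uv: "u\<^sup>2 + v\<^sup>2 = (dist x y)\<^sup>2"
      by (simp add: u_def v_def dist_prod_def dist_real_def power2_commute)
    have d2: "dist x y \<le> 2"
      using \<open>x \<in> disk\<close> \<open>y \<in> disk\<close> dist_triangle2[of x y 0] by (simp add: disk_eq_cball dist_commute)
    have pos: "dist x y > 0" using \<open>x \<noteq> y\<close> by simp
    \<comment> \<open>A sine wave along the segment from \<open>x\<close> to \<open>y\<close> that vanishes at \<open>x\<close>; it is positive at \<open>y\<close>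
      because the diameter of the disk is less than \<open>\<pi>\<close>.\<close>
    define c where "c = - (u * fst x + v * snd x) / dist x y - pi / 2"
    define W where "W = (\<lambda>z. 1 * cos (u / dist x y * fst z + v / dist x y * snd z + c))"
    have "W x = 0"
    proof -
      have "u / dist x y * fst x + v / dist x y * snd x + c = - (pi / 2)"
        by (simp add: c_def add_divide_distrib diff_divide_distrib)
      then show ?thesis by (simp add: W_def)
    qed
    moreover have "W y = sin (dist x y)"
    proof -
      have "u / dist x y * fst y + v / dist x y * snd y + c = (u\<^sup>2 + v\<^sup>2) / dist x y - pi / 2"
        by (simp add: c_def u_def v_def power2_eq_square algebra_simps add_divide_distrib diff_divide_distrib)
      also have "\<dots> = dist x y - pi / 2" unfolding uv using pos by (simp add: power2_eq_square)
      finally show ?thesis by (simp add: W_def cos_diff)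
    qed
    moreover have "sin (dist x y) > 0" using pos d2 pi_gt3 by (intro sin_gt_zero) auto
    ultimately have "W x \<noteq> W y" by simp
    moreover have "W \<in> wave_span" unfolding W_def by (rule wave_span.wave)
    ultimately show "\<exists>f\<in>wave_span. f x \<noteq> f y" by blast
  qed (auto simp: compact_disk continuous_on_wave_span wave_span.add wave_span_mult)
  show ?thesis
  proof (rule sup_functional_approx_zero[OF assms])
    fix e :: real assume "e > 0"
    then obtain W where "W \<in> wave_span" "\<forall>x\<in>disk. \<bar>F x - W x\<bar> < e"
      using Stone_Weierstrass_basic[OF assms] by blast
    then show "\<exists>G. continuous_on disk G \<and> L G = 0 \<and> (\<forall>x\<in>disk. \<bar>F x - G x\<bar> \<le> e)"
      by (intro exI[of _ W]) (auto simp: continuous_on_wave_span annihilates_wave_span less_imp_le)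
  qed
qed

end
end

section \<open>Integrals over chords and over the disk\<close>

text \<open>
  The chord at distance \<open>cos \<psi>\<close> is parametrised over the fixed interval \<open>[-1, 1]\<close>; its
  half-length \<open>sin \<psi>\<close> is left out as a factor (\<open>radon_eq_chord_int\<close>). In this form the integral
  is defined for all \<open>\<psi>\<close>, depends continuously on it, and is even and \<open>2\<pi>\<close>-periodic.
\<close>

definition chord_int :: "(real \<times> real \<Rightarrow> real) \<Rightarrow> real \<Rightarrow> real \<Rightarrow> real" where
  "chord_int F \<phi> \<psi> = integral {-1..1} (\<lambda>s. F (line_point \<phi> (cos \<psi>) (s * sin \<psi>)))"

lemma line_point_norm: "(fst (line_point \<phi> t s))\<^sup>2 + (snd (line_point \<phi> t s))\<^sup>2 = t\<^sup>2 + s\<^sup>2"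
  using sin_cos_squared_add[of \<phi>] unfolding line_point_def fst_conv snd_conv by algebra

lemma line_point_in_disk:
  assumes "s \<in> {-1..1}" shows "line_point \<phi> (cos \<psi>) (s * sin \<psi>) \<in> disk"
proof -
  have "s\<^sup>2 * (sin \<psi>)\<^sup>2 \<le> 1 * (sin \<psi>)\<^sup>2"
    using assms by (intro mult_right_mono) (auto simp: abs_square_le_1 abs_le_iff)
  then have "(cos \<psi>)\<^sup>2 + (s * sin \<psi>)\<^sup>2 \<le> 1"
    using sin_cos_squared_add[of \<psi>] unfolding power_mult_distrib by linarith
  then show ?thesis
    using line_point_norm[of \<phi> "cos \<psi>" "s * sin \<psi>"] by (simp add: disk_def case_prod_beta)
qed

lemma continuous_on_line_point:
  "continuous_on S (\<lambda>z. line_point \<phi> (cos (fst z)) (snd z * sin (fst z)))"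
  unfolding line_point_def by (intro continuous_intros)

lemma continuous_on_chord_param:
  assumes "continuous_on disk F"
  shows "continuous_on (A \<times> {-1..1}) (\<lambda>(\<psi>, s). F (line_point \<phi> (cos \<psi>) (s * sin \<psi>)))"
  unfolding case_prod_beta
  by (rule continuous_on_compose2[OF assms continuous_on_line_point])
     (auto intro!: line_point_in_disk)

lemma continuous_on_chord_slice:
  assumes "continuous_on disk F"
  shows "continuous_on {-1..1} (\<lambda>s. F (line_point \<phi> (cos \<psi>) (s * sin \<psi>)))"
proof (rule continuous_on_compose2[OF assms])
  show "continuous_on {-1..1} (\<lambda>s. line_point \<phi> (cos \<psi>) (s * sin \<psi>))"
    unfolding line_point_def by (intro continuous_intros)
qed (auto intro!: line_point_in_disk)

lemma continuous_on_chord_int: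
  assumes "continuous_on disk F"
  shows "continuous_on A (chord_int F \<phi>)"
proof -
  have "continuous_on A (\<lambda>\<psi>. integral (cbox (-1) 1) (\<lambda>s. F (line_point \<phi> (cos \<psi>) (s * sin \<psi>))))"
    by (rule integral_continuous_on_param) (use continuous_on_chord_param[OF assms] in simp)
  then show ?thesis by (simp add: chord_int_def[abs_def])
qed

lemma abs_chord_int_le:
  assumes "continuous_on disk F" "\<And>x. x \<in> disk \<Longrightarrow> \<bar>F x\<bar> \<le> e"
  shows "\<bar>chord_int F \<phi> \<psi>\<bar> \<le> 2 * e"
proof -
  have "norm (integral {-1..1} (\<lambda>s. F (line_point \<phi> (cos \<psi>) (s * sin \<psi>)))) \<le> e * (1 - (-1))"
    by (rule integral_bound[OF _ continuous_on_chord_slice[OF assms(1)]])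
       (auto intro!: assms(2) line_point_in_disk)
  then show ?thesis by (simp add: chord_int_def)
qed

lemma chord_int_add:
  assumes "continuous_on disk F" "continuous_on disk G"
  shows "chord_int (\<lambda>x. F x + G x) \<phi> \<psi> = chord_int F \<phi> \<psi> + chord_int G \<phi> \<psi>"
  unfolding chord_int_def
  by (intro integral_add integrable_continuous_real continuous_on_chord_slice assms)

lemma sup_functional_chord_int: "sup_functional (\<lambda>F. chord_int F \<phi> \<psi>)"
proof (rule sup_functionalI[where C = 2])
  fix c :: real and F :: "real \<times> real \<Rightarrow> real"
  show "chord_int (\<lambda>x. c * F x) \<phi> \<psi> = c * chord_int F \<phi> \<psi>"
    by (simp add: chord_int_def)
qed (simp_all add: chord_int_add abs_chord_int_le)

lemma sup_functional_weighted_chord_int: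
  assumes w: "continuous_on {0..pi} w"
  shows "sup_functional (\<lambda>F. integral {0..pi} (\<lambda>\<psi>. w \<psi> * chord_int F \<phi> \<psi>))"
proof -
  obtain B where B: "\<And>\<psi>. \<psi> \<in> {0..pi} \<Longrightarrow> \<bar>w \<psi>\<bar> \<le> B"
    using compact_imp_bounded[OF compact_continuous_image[OF w compact_Icc]]
    by (force simp: bounded_iff)
  have "0 \<le> \<bar>w 0\<bar>" by simp
  also have "\<dots> \<le> B" by (rule B) simp
  finally have B0: "B \<ge> 0" .
  show ?thesis
  proof (rule sup_functionalI[where C = "B * 2 * pi"])
    fix F G :: "real \<times> real \<Rightarrow> real" assume FG: "continuous_on disk F" "continuous_on disk G"
    show "integral {0..pi} (\<lambda>\<psi>. w \<psi> * chord_int (\<lambda>x. F x + G x) \<phi> \<psi>) =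
      integral {0..pi} (\<lambda>\<psi>. w \<psi> * chord_int F \<phi> \<psi>) + integral {0..pi} (\<lambda>\<psi>. w \<psi> * chord_int G \<phi> \<psi>)"
      unfolding chord_int_add[OF FG] distrib_left
      by (intro integral_add integrable_continuous_real continuous_intros w continuous_on_chord_int FG)
  next
    fix c :: real and F :: "real \<times> real \<Rightarrow> real"
    show "integral {0..pi} (\<lambda>\<psi>. w \<psi> * chord_int (\<lambda>x. c * F x) \<phi> \<psi>) = c * integral {0..pi} (\<lambda>\<psi>. w \<psi> * chord_int F \<phi> \<psi>)"
      by (simp add: chord_int_def mult.left_commute[of _ c])
  next
    fix F :: "real \<times> real \<Rightarrow> real" and e assume F: "continuous_on disk F" "\<And>x. x \<in> disk \<Longrightarrow> \<bar>F x\<bar> \<le> e"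
    have "norm (integral {0..pi} (\<lambda>\<psi>. w \<psi> * chord_int F \<phi> \<psi>)) \<le> (B * (2 * e)) * (pi - 0)"
    proof (rule integral_bound)
      show "continuous_on {0..pi} (\<lambda>\<psi>. w \<psi> * chord_int F \<phi> \<psi>)"
        by (intro continuous_intros w continuous_on_chord_int F)
      fix \<psi> assume "\<psi> \<in> {0..pi}"
      then show "norm (w \<psi> * chord_int F \<phi> \<psi>) \<le> B * (2 * e)"
        unfolding real_norm_def abs_mult
        by (intro mult_mono B abs_chord_int_le F B0) auto
    qed simp
    then show "\<bar>integral {0..pi} (\<lambda>\<psi>. w \<psi> * chord_int F \<phi> \<psi>)\<bar> \<le> B * 2 * pi * e"
      by (simp add: mult_ac)
  qed (use B0 in simp)
qed

text \<open>
  On a chord a ridge function is \<open>U\<^sub>n\<close> of an affine function of the parameter with slope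
  \<open>sin \<psi> sin(\<eta> - \<phi>)\<close>, and \<open>T\<^sub>n\<^sub>+\<^sub>1/(n + 1)\<close> is an antiderivative of \<open>U\<^sub>n\<close>; at the end points
  its values are cosines. The slope can vanish identically in \<open>\<psi>\<close>: then \<open>\<eta> - \<phi>\<close> is a multiple
  of \<open>\<pi>\<close> and the ridge function is constant along the chord.
\<close>

lemma chord_int_ridge:
  "sin \<psi> * chord_int (\<lambda>x. cheb_U n (coord \<eta> x)) \<phi> \<psi> =
    2 / (real n + 1) * sin ((real n + 1) * \<psi>) * cheb_U n (cos (\<eta> - \<phi>))"
proof -
  define \<alpha> where "\<alpha> = \<eta> - \<phi>"
  have ci: "chord_int (\<lambda>x. cheb_U n (coord \<eta> x)) \<phi> \<psi> =
     integral {-1..1} (\<lambda>s. cheb_U n (cos \<psi> * cos \<alpha> + s * sin \<psi> * sin \<alpha>))"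
    by (simp add: chord_int_def coord_line_point \<alpha>_def)
  show ?thesis
  proof (cases "sin \<alpha> = 0")
    case True
    have c: "chord_int (\<lambda>x. cheb_U n (coord \<eta> x)) \<phi> \<psi> = 2 * cheb_U n (cos (\<psi> + \<alpha>))"
      by (simp add: ci True cos_add)
    have sq: "(cos \<alpha>)\<^sup>2 = 1" using True by (simp add: cos_squared_eq)
    have "sin ((real n + 1) * \<alpha>) = 0" using sin_mult_cheb_U[of \<alpha> n] True by simp
    moreover have "cos ((real n + 1) * \<alpha>) = cos \<alpha> ^ Suc n"
      using cheb_T_cos[of "Suc n" \<alpha>] cheb_T_sq_eq_1[OF sq, of "Suc n"] by (simp add: add.commute)
    ultimately have "sin \<psi> * cos \<alpha> * cheb_U n (cos (\<psi> + \<alpha>)) = sin ((real n + 1) * \<psi>) * cos \<alpha> ^ Suc n"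
      using sin_mult_cheb_U[of "\<psi> + \<alpha>" n] by (simp add: sin_add True distrib_left)
    then have "cos \<alpha> * (sin \<psi> * cheb_U n (cos (\<psi> + \<alpha>))) = cos \<alpha> * (sin ((real n + 1) * \<psi>) * cos \<alpha> ^ n)"
      by (simp add: mult_ac)
    moreover have "cos \<alpha> \<noteq> 0" using sq by auto
    ultimately have "sin \<psi> * cheb_U n (cos (\<psi> + \<alpha>)) = sin ((real n + 1) * \<psi>) * cos \<alpha> ^ n"
      by simp
    then show ?thesis
      unfolding c \<alpha>_def[symmetric] cheb_U_sq_eq_1[OF sq] by simp
  next
    case False
    have "((\<lambda>s. (real n + 1) * cheb_U n (cos \<psi> * cos \<alpha> + s * sin \<psi> * sin \<alpha>) * (sin \<psi> * sin \<alpha>)) has_integral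
       cheb_T (Suc n) (cos \<psi> * cos \<alpha> + 1 * sin \<psi> * sin \<alpha>) - cheb_T (Suc n) (cos \<psi> * cos \<alpha> + (-1) * sin \<psi> * sin \<alpha>)) {-1..1}"
    proof (rule fundamental_theorem_of_calculus)
      fix s :: real
      have "((\<lambda>s. cheb_T (Suc n) (cos \<psi> * cos \<alpha> + s * sin \<psi> * sin \<alpha>)) has_real_derivative
        ((real n + 1) * cheb_U n (cos \<psi> * cos \<alpha> + s * sin \<psi> * sin \<alpha>)) * (sin \<psi> * sin \<alpha>)) (at s within {-1..1})"
        by (rule DERIV_chain'[OF _ DERIV_cheb_T]) (auto intro!: derivative_eq_intros)
      then show "((\<lambda>s. cheb_T (Suc n) (cos \<psi> * cos \<alpha> + s * sin \<psi> * sin \<alpha>)) has_vector_derivative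
        (real n + 1) * cheb_U n (cos \<psi> * cos \<alpha> + s * sin \<psi> * sin \<alpha>) * (sin \<psi> * sin \<alpha>)) (at s within {-1..1})"
        by (simp add: has_real_derivative_iff_has_vector_derivative)
    qed simp
    then have "(real n + 1) * sin \<psi> * sin \<alpha> * chord_int (\<lambda>x. cheb_U n (coord \<eta> x)) \<phi> \<psi>
       = cheb_T (Suc n) (cos (\<psi> - \<alpha>)) - cheb_T (Suc n) (cos (\<psi> + \<alpha>))"
      by (simp add: ci cos_diff cos_add mult_ac integral_unique flip: integral_mult_right)
    also have "\<dots> = 2 * sin ((real n + 1) * \<psi>) * sin ((real n + 1) * \<alpha>)"
    proof -
      have "real (Suc n) * (\<psi> - \<alpha>) = (real n + 1) * \<psi> - (real n + 1) * \<alpha>"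
        "real (Suc n) * (\<psi> + \<alpha>) = (real n + 1) * \<psi> + (real n + 1) * \<alpha>"
        by (simp_all add: algebra_simps)
      then show ?thesis unfolding cheb_T_cos by (simp only: cos_diff cos_add)
    qed
    also have "\<dots> = sin \<alpha> * (2 * sin ((real n + 1) * \<psi>) * cheb_U n (cos \<alpha>))"
      by (simp add: sin_mult_cheb_U[symmetric])
    finally have "sin \<alpha> * ((real n + 1) * (sin \<psi> * chord_int (\<lambda>x. cheb_U n (coord \<eta> x)) \<phi> \<psi>)) = \<dots>"
      by (simp add: mult_ac)
    then have "(real n + 1) * (sin \<psi> * chord_int (\<lambda>x. cheb_U n (coord \<eta> x)) \<phi> \<psi>) = 2 * sin ((real n + 1) * \<psi>) * cheb_U n (cos \<alpha>)"
      using False by simp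
    then show ?thesis by (simp add: \<alpha>_def field_simps)
  qed
qed

lemma has_integral_cos_int:
  assumes "j \<noteq> 0"
  shows "((\<lambda>\<psi>. cos (of_int j * \<psi>)) has_integral 0) {0..pi}"
proof -
  have "((\<lambda>\<psi>. cos (of_int j * \<psi>)) has_integral (sin (of_int j * pi) / of_int j - sin (of_int j * 0) / of_int j)) {0..pi}"
    by (rule fundamental_theorem_of_calculus)
       (use assms in \<open>auto intro!: derivative_eq_intros simp flip: has_real_derivative_iff_has_vector_derivative\<close>)
  then show ?thesis by (simp add: mult.commute[of _ pi] sin_npi_int)
qed

lemma integral_sin_sin:
  "integral {0..pi} (\<lambda>\<psi>. sin ((real k + 1) * \<psi>) * sin ((real n + 1) * \<psi>)) = (if k = n then pi / 2 else 0)"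
proof -
  have eq: "sin ((real k + 1) * \<psi>) * sin ((real n + 1) * \<psi>) =
    (cos (of_int (int k - int n) * \<psi>) - cos (of_int (int k + int n + 2) * \<psi>)) / 2" for \<psi>
    unfolding sin_times_sin by (simp add: algebra_simps)
  have 1: "((\<lambda>\<psi>. cos (of_int (int k + int n + 2) * \<psi>)) has_integral 0) {0..pi}"
    by (rule has_integral_cos_int) simp
  have 2: "((\<lambda>\<psi>. cos (of_int (int k - int n) * \<psi>)) has_integral (if k = n then pi else 0)) {0..pi}"
    using has_integral_cos_int[of "int k - int n"] has_integral_const_real[of "1::real" 0 pi] by auto
  have "integral {0..pi} (\<lambda>\<psi>. sin ((real k + 1) * \<psi>) * sin ((real n + 1) * \<psi>)) = ((if k = n then pi else 0) - 0) / 2"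
    unfolding eq by (intro integral_unique has_integral_divide has_integral_diff 1 2)
  then show ?thesis by (cases "k = n") simp_all
qed

text \<open>
  The integral of \<open>F\<close> over the disk in coordinates rotated by \<open>\<phi>\<close>, as an iterated integral with
  outer variable \<open>cos \<psi>\<close>: one factor \<open>sin \<psi>\<close> is the half-length of the chord, the other
  comes from the substitution.
\<close>

definition disk_int :: "(real \<times> real \<Rightarrow> real) \<Rightarrow> real \<Rightarrow> real" where
  "disk_int F \<phi> = integral {0..pi} (\<lambda>\<psi>. (sin \<psi>)\<^sup>2 * chord_int F \<phi> \<psi>)"

lemma sup_functional_disk_int: "sup_functional (\<lambda>F. disk_int F \<phi>)"
  unfolding disk_int_def by (intro sup_functional_weighted_chord_int continuous_intros)

lemma sup_functional_minus:
  assumes L: "sup_functional L" and M: "sup_functional M"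
  shows "sup_functional (\<lambda>F. L F - M F)"
proof -
  obtain B where B: "B \<ge> 0"
    "\<And>F e. continuous_on disk F \<Longrightarrow> (\<And>x. x \<in> disk \<Longrightarrow> \<bar>F x\<bar> \<le> e) \<Longrightarrow> \<bar>L F\<bar> \<le> B * e"
    using sup_functional_bound[OF L] by blast
  obtain C where C: "C \<ge> 0"
    "\<And>F e. continuous_on disk F \<Longrightarrow> (\<And>x. x \<in> disk \<Longrightarrow> \<bar>F x\<bar> \<le> e) \<Longrightarrow> \<bar>M F\<bar> \<le> C * e"
    using sup_functional_bound[OF M] by blast
  show ?thesis
  proof (rule sup_functionalI[where C = "B + C"])
    fix F :: "real \<times> real \<Rightarrow> real" and e assume "continuous_on disk F" "\<And>x. x \<in> disk \<Longrightarrow> \<bar>F x\<bar> \<le> e"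
    then show "\<bar>L F - M F\<bar> \<le> (B + C) * e"
      using B(2)[of F e] C(2)[of F e] by (simp add: distrib_right)
  qed (use B C in \<open>simp_all add: sup_functional_add[OF L] sup_functional_add[OF M]
      sup_functional_scale[OF L] sup_functional_scale[OF M] right_diff_distrib\<close>)
qed

lemma sup_functional_mult:
  assumes L: "sup_functional L" and G: "continuous_on disk G"
  shows "sup_functional (\<lambda>F. L (\<lambda>x. G x * F x))"
proof -
  obtain B where B: "B \<ge> 0"
    "\<And>F e. continuous_on disk F \<Longrightarrow> (\<And>x. x \<in> disk \<Longrightarrow> \<bar>F x\<bar> \<le> e) \<Longrightarrow> \<bar>L F\<bar> \<le> B * e"
    using sup_functional_bound[OF L] by blast
  obtain C where "\<And>x. x \<in> disk \<Longrightarrow> \<bar>G x\<bar> \<le> C"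
    using compact_imp_bounded[OF compact_continuous_image[OF G compact_disk]]
    by (force simp: bounded_iff)
  then have C: "\<And>x. x \<in> disk \<Longrightarrow> \<bar>G x\<bar> \<le> \<bar>C\<bar>" by force
  show ?thesis
  proof (rule sup_functionalI[where C = "B * \<bar>C\<bar>"])
    fix F :: "real \<times> real \<Rightarrow> real" and e assume F: "continuous_on disk F" "\<And>x. x \<in> disk \<Longrightarrow> \<bar>F x\<bar> \<le> e"
    have "\<bar>L (\<lambda>x. G x * F x)\<bar> \<le> B * (\<bar>C\<bar> * e)"
      using F C by (intro B(2)) (auto intro!: continuous_intros G mult_mono simp: abs_mult)
    then show "\<bar>L (\<lambda>x. G x * F x)\<bar> \<le> B * \<bar>C\<bar> * e" by (simp add: mult_ac)
  qed (use B G in \<open>simp_all add: distrib_left sup_functional_add[OF L] mult.left_commute[of "G _"]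
      sup_functional_scale[OF L] continuous_on_mult\<close>)
qed

text \<open>
  By density only ridge functions have to be considered. For them the integral is a product of
  two sine functions integrated over \<open>[0, \<pi>]\<close>, which vanishes unless \<open>n = 0\<close>; and \<open>U\<^sub>0 = 1\<close> does not
  depend on the direction.
\<close>

theorem disk_int_rotation_invariant:
  assumes "continuous_on disk F"
  shows "disk_int F \<phi> = disk_int F 0"
proof -
  have ridge: "disk_int (\<lambda>x. cheb_U n (coord \<eta> x)) \<phi> = (if n = 0 then pi else 0)" for n \<eta> \<phi>
  proof -
    have "(sin \<psi>)\<^sup>2 * chord_int (\<lambda>x. cheb_U n (coord \<eta> x)) \<phi> \<psi> =
      (2 / (real n + 1) * cheb_U n (cos (\<eta> - \<phi>))) * (sin ((real n + 1) * \<psi>) * sin ((real 0 + 1) * \<psi>))" for \<psi>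
      unfolding power2_eq_square mult.assoc chord_int_ridge by simp
    then have "disk_int (\<lambda>x. cheb_U n (coord \<eta> x)) \<phi> = (2 / (real n + 1) * cheb_U n (cos (\<eta> - \<phi>))) * (if n = 0 then pi / 2 else 0)"
      unfolding disk_int_def by (simp only: integral_mult_right integral_sin_sin)
    then show ?thesis by simp
  qed
  have "disk_int F \<phi> - disk_int F 0 = 0"
    by (rule ridge_total[OF sup_functional_minus[OF sup_functional_disk_int sup_functional_disk_int] _ assms])
       (simp add: ridge)
  then show ?thesis by simp
qed

section \<open>Sine coefficients of the Radon projection\<close>

definition radon_coeff :: "(real \<times> real \<Rightarrow> real) \<Rightarrow> nat \<Rightarrow> real \<Rightarrow> real" where
  "radon_coeff F n \<phi> = 2 / pi * integral {0..pi} (\<lambda>\<psi>. (sin ((real n + 1) * \<psi>) * sin \<psi>) * chord_int F \<phi> \<psi>)"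

lemma sup_functional_scaled:
  assumes "sup_functional L" shows "sup_functional (\<lambda>F. c * L F)"
proof -
  obtain B where B: "B \<ge> 0"
    "\<And>F e. continuous_on disk F \<Longrightarrow> (\<And>x. x \<in> disk \<Longrightarrow> \<bar>F x\<bar> \<le> e) \<Longrightarrow> \<bar>L F\<bar> \<le> B * e"
    using sup_functional_bound[OF assms] by blast
  show ?thesis
  proof (rule sup_functionalI[where C = "\<bar>c\<bar> * B"])
    fix F :: "real \<times> real \<Rightarrow> real" and e assume "continuous_on disk F" "\<And>x. x \<in> disk \<Longrightarrow> \<bar>F x\<bar> \<le> e"
    then show "\<bar>c * L F\<bar> \<le> \<bar>c\<bar> * B * e"
      unfolding abs_mult mult.assoc by (intro mult_left_mono B(2)) auto
  qed (use B in \<open>simp_all add: sup_functional_add[OF assms] sup_functional_scale[OF assms] distrib_left\<close>)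
qed

lemma sup_functional_radon_coeff: "sup_functional (\<lambda>F. radon_coeff F n \<phi>)"
  unfolding radon_coeff_def
  by (intro sup_functional_scaled sup_functional_weighted_chord_int continuous_intros)

text \<open>
  A function of \<open>coord \<phi>\<close> is constant on the chords in the frame rotated by \<open>\<phi>\<close>, so the
  coefficient is an integral over the disk; rotation invariance then removes the frame. The
  dependence on \<open>\<phi>\<close> is now carried by the ridge function alone.
\<close>

lemma radon_coeff_eq_disk_int:
  assumes "continuous_on disk F"
  shows "radon_coeff F n \<phi> = 2 / pi * disk_int (\<lambda>x. F x * cheb_U n (coord \<phi> x)) 0"
proof -
  have "chord_int (\<lambda>x. F x * cheb_U n (coord \<phi> x)) \<phi> \<psi> = chord_int F \<phi> \<psi> * cheb_U n (cos \<psi>)" for \<psi>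
    by (simp add: chord_int_def coord_line_point)
  then have "(sin \<psi>)\<^sup>2 * chord_int (\<lambda>x. F x * cheb_U n (coord \<phi> x)) \<phi> \<psi>
      = sin ((real n + 1) * \<psi>) * sin \<psi> * chord_int F \<phi> \<psi>" for \<psi>
    unfolding sin_mult_cheb_U[symmetric] by (simp add: power2_eq_square mult_ac)
  then have "radon_coeff F n \<phi> = 2 / pi * disk_int (\<lambda>x. F x * cheb_U n (coord \<phi> x)) \<phi>"
    by (simp only: radon_coeff_def disk_int_def)
  also have "disk_int (\<lambda>x. F x * cheb_U n (coord \<phi> x)) \<phi> = disk_int (\<lambda>x. F x * cheb_U n (coord \<phi> x)) 0"
    by (intro disk_int_rotation_invariant continuous_intros assms)
  finally show ?thesis .
qed

lemma radon_coeff_reproducing: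
  assumes "continuous_on disk F" "n \<le> 2 * m"
  shows "(\<Sum>\<nu>=0..2*m. radon_coeff F n (phi m \<nu>) * cheb_U n (cos (phi m \<nu> - \<eta>))) = (2 * real m + 1) * radon_coeff F n \<eta>"
proof -
  have L: "sup_functional (\<lambda>H. disk_int (\<lambda>x. F x * H x) 0)"
    by (intro sup_functional_mult sup_functional_disk_int assms)
  have "(\<Sum>\<nu>=0..2*m. radon_coeff F n (phi m \<nu>) * cheb_U n (cos (phi m \<nu> - \<eta>)))
    = 2 / pi * (\<Sum>\<nu>=0..2*m. disk_int (\<lambda>x. F x * (cheb_U n (cos (phi m \<nu> - \<eta>)) * cheb_U n (coord (phi m \<nu>) x))) 0)"
    unfolding sum_distrib_left
  proof (intro sum.cong refl)
    fix \<nu>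
    have "disk_int (\<lambda>x. F x * (cheb_U n (cos (phi m \<nu> - \<eta>)) * cheb_U n (coord (phi m \<nu>) x))) 0
       = cheb_U n (cos (phi m \<nu> - \<eta>)) * disk_int (\<lambda>x. F x * cheb_U n (coord (phi m \<nu>) x)) 0"
      by (rule sup_functional_scale[OF L]) (intro continuous_intros)
    then show "radon_coeff F n (phi m \<nu>) * cheb_U n (cos (phi m \<nu> - \<eta>)) =
      2 / pi * disk_int (\<lambda>x. F x * (cheb_U n (cos (phi m \<nu> - \<eta>)) * cheb_U n (coord (phi m \<nu>) x))) 0"
      by (simp add: radon_coeff_eq_disk_int[OF assms(1)])
  qed
  also have "(\<Sum>\<nu>=0..2*m. disk_int (\<lambda>x. F x * (cheb_U n (cos (phi m \<nu> - \<eta>)) * cheb_U n (coord (phi m \<nu>) x))) 0)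
    = disk_int (\<lambda>x. F x * (\<Sum>\<nu>=0..2*m. cheb_U n (cos (phi m \<nu> - \<eta>)) * cheb_U n (coord (phi m \<nu>) x))) 0"
    by (rule sup_functional_sum[OF L, symmetric]) (auto intro!: continuous_intros)
  also have "(\<lambda>x. \<Sum>\<nu>=0..2*m. cheb_U n (cos (phi m \<nu> - \<eta>)) * cheb_U n (coord (phi m \<nu>) x))
     = (\<lambda>x. (2 * real m + 1) * cheb_U n (coord \<eta> x))"
    using ridge_reproducing[OF assms(2)] by (simp add: mult.commute)
  also have "disk_int (\<lambda>x. F x * ((2 * real m + 1) * cheb_U n (coord \<eta> x))) 0 = (2 * real m + 1) * disk_int (\<lambda>x. F x * cheb_U n (coord \<eta> x)) 0"
    by (rule sup_functional_scale[OF L]) (intro continuous_intros)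
  finally show ?thesis by (simp add: radon_coeff_eq_disk_int[OF assms(1)])
qed

text \<open>
  Uniqueness for the Radon transform on \<open>C(B)\<close>: integration against \<open>F\<close> annihilates all ridge
  functions, hence \<open>F\<close> itself, so the integral of \<open>F\<^sup>2\<close> is zero.
\<close>

theorem radon_coeff_zero_imp_zero:
  assumes F: "continuous_on disk F" and zero: "\<And>n \<eta>. radon_coeff F n \<eta> = 0" and "p \<in> disk"
  shows "F p = 0"
proof -
  have "disk_int (\<lambda>x. F x * cheb_U n (coord \<eta> x)) 0 = 0" for n \<eta>
    using radon_coeff_eq_disk_int[OF F] zero by (metis divide_eq_0_iff mult_eq_0_iff pi_neq_zero zero_neq_numeral)
  then have "disk_int (\<lambda>x. F x * F x) 0 = 0"
    by (intro ridge_total[OF sup_functional_mult[OF sup_functional_disk_int F] _ F])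
  moreover have FF: "continuous_on disk (\<lambda>x. F x * F x)" by (intro continuous_intros F)
  ultimately have di: "disk_int (\<lambda>x. F x * F x) \<phi> = 0" for \<phi>
    using disk_int_rotation_invariant by metis
  obtain \<rho> \<beta> where p: "fst p = \<rho> * cos \<beta>" "snd p = \<rho> * sin \<beta>"
    using polar_Ex by metis
  \<comment> \<open>Put \<open>p\<close> on the chord through the origin in direction \<open>\<beta>\<close>, that is \<open>\<psi> = \<pi>/2\<close>. There the weight
    \<open>(sin \<psi>)\<^sup>2\<close> is positive, also if \<open>p\<close> lies on the boundary circle.\<close>
  define \<phi> where "\<phi> = \<beta> - pi / 2"
  have pl: "p = line_point \<phi> (cos (pi / 2)) (\<rho> * sin (pi / 2))"
    using p by (simp add: line_point_def \<phi>_def prod_eq_iff cos_diff sin_diff)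
  have "\<rho>\<^sup>2 \<le> 1"
    using \<open>p \<in> disk\<close> line_point_norm[of \<phi> "cos (pi / 2)" "\<rho> * sin (pi / 2)"]
    unfolding pl[symmetric] by (simp add: disk_def case_prod_beta)
  then have \<rho>: "\<rho> \<in> {-1..1}" by (auto simp: abs_square_le_1 abs_le_iff)
  have nn: "chord_int (\<lambda>x. F x * F x) \<phi> \<psi> \<ge> 0" for \<psi>
    unfolding chord_int_def
    by (intro integral_nonneg integrable_continuous_real continuous_on_chord_slice FF) auto
  have "\<forall>\<psi>\<in>{0..pi}. (sin \<psi>)\<^sup>2 * chord_int (\<lambda>x. F x * F x) \<phi> \<psi> = 0"
    using di[of \<phi>] nn unfolding disk_int_def
    by (subst (asm) integral_eq_0_iff) (auto intro!: continuous_intros continuous_on_chord_int FF)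
  then have "chord_int (\<lambda>x. F x * F x) \<phi> (pi / 2) = 0"
    by (auto dest!: bspec[of _ _ "pi / 2"])
  then have "\<forall>s\<in>{-1..1}. F (line_point \<phi> (cos (pi / 2)) (s * sin (pi / 2))) * F (line_point \<phi> (cos (pi / 2)) (s * sin (pi / 2))) = 0"
    unfolding chord_int_def
    by (subst (asm) integral_eq_0_iff) (auto intro!: continuous_on_chord_slice[OF FF] simp del: cos_pi_half sin_pi_half)
  with \<rho> show ?thesis unfolding pl by (metis mult_eq_0_iff)
qed

section \<open>Decay of the sine coefficients\<close>

text \<open>
  Families of \<open>2\<pi>\<close>-periodic functions, indexed by \<open>I\<close>, with bounds that hold for the whole
  family. In the application the index is the angle together with the position on the chord.
\<close>

definition unif_periodic :: "'i set \<Rightarrow> ('i \<Rightarrow> real \<Rightarrow> real) \<Rightarrow> bool" where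
  "unif_periodic I u \<longleftrightarrow> (\<forall>i\<in>I. continuous_on UNIV (u i) \<and> (\<forall>x. u i (x + 2 * pi) = u i x)) \<and>
     (\<exists>B. \<forall>i\<in>I. \<forall>x. \<bar>u i x\<bar> \<le> B)"

primrec unif_smooth :: "nat \<Rightarrow> 'i set \<Rightarrow> ('i \<Rightarrow> real \<Rightarrow> real) \<Rightarrow> bool" where
  "unif_smooth 0 I u \<longleftrightarrow> unif_periodic I u"
| "unif_smooth (Suc n) I u \<longleftrightarrow> unif_periodic I u \<and>
     (\<exists>u'. unif_smooth n I u' \<and> (\<forall>i\<in>I. \<forall>x. (u i has_real_derivative u' i x) (at x)))"

lemma unif_smooth_imp_periodic: "unif_smooth n I u \<Longrightarrow> unif_periodic I u"
  by (cases n) auto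

lemma unif_smooth_Suc_imp: "unif_smooth (Suc n) I u \<Longrightarrow> unif_smooth n I u"
proof (induction n arbitrary: u)
  case (Suc n)
  then show ?case by (metis unif_smooth.simps(2))
qed auto

lemma unif_periodic_add:
  assumes "unif_periodic I u" "unif_periodic I v"
  shows "unif_periodic I (\<lambda>i x. u i x + v i x)"
proof -
  obtain B C where "\<forall>i\<in>I. \<forall>x. \<bar>u i x\<bar> \<le> B" "\<forall>i\<in>I. \<forall>x. \<bar>v i x\<bar> \<le> C"
    using assms unfolding unif_periodic_def by blast
  then have "\<forall>i\<in>I. \<forall>x. \<bar>u i x + v i x\<bar> \<le> B + C"
    by (meson abs_triangle_ineq add_mono order_trans)
  then show ?thesis
    using assms unfolding unif_periodic_def by (auto intro!: continuous_on_add)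
qed

lemma unif_periodic_mult:
  assumes "unif_periodic I u" "unif_periodic I v"
  shows "unif_periodic I (\<lambda>i x. u i x * v i x)"
proof -
  obtain B C where B: "\<forall>i\<in>I. \<forall>x. \<bar>u i x\<bar> \<le> B" "\<forall>i\<in>I. \<forall>x. \<bar>v i x\<bar> \<le> C"
    using assms unfolding unif_periodic_def by blast
  have "\<bar>u i x * v i x\<bar> \<le> \<bar>B\<bar> * \<bar>C\<bar>" if "i \<in> I" for i x
    unfolding abs_mult using B that by (intro mult_mono) (auto intro: order_trans[OF _ abs_ge_self])
  then have "\<exists>B. \<forall>i\<in>I. \<forall>x. \<bar>u i x * v i x\<bar> \<le> B" by blast
  then show ?thesis
    using assms unfolding unif_periodic_def by (auto intro!: continuous_on_mult)
qed

lemma unif_smooth_add: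
  "unif_smooth n I u \<Longrightarrow> unif_smooth n I v \<Longrightarrow> unif_smooth n I (\<lambda>i x. u i x + v i x)"
proof (induction n arbitrary: u v)
  case 0 then show ?case by (simp add: unif_periodic_add)
next
  case (Suc n)
  obtain u' v' where "unif_smooth n I u'" "\<forall>i\<in>I. \<forall>x. (u i has_real_derivative u' i x) (at x)"
    "unif_smooth n I v'" "\<forall>i\<in>I. \<forall>x. (v i has_real_derivative v' i x) (at x)"
    using Suc.prems by auto
  then show ?case
    using Suc.prems
    by (auto intro!: unif_periodic_add exI[of _ "\<lambda>i x. u' i x + v' i x"] Suc.IH DERIV_add)
qed

lemma unif_smooth_mult:
  "unif_smooth n I u \<Longrightarrow> unif_smooth n I v \<Longrightarrow> unif_smooth n I (\<lambda>i x. u i x * v i x)"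
proof (induction n arbitrary: u v)
  case 0 then show ?case by (simp add: unif_periodic_mult)
next
  case (Suc n)
  obtain u' v' where u': "unif_smooth n I u'" "\<forall>i\<in>I. \<forall>x. (u i has_real_derivative u' i x) (at x)"
    and v': "unif_smooth n I v'" "\<forall>i\<in>I. \<forall>x. (v i has_real_derivative v' i x) (at x)"
    using Suc.prems by auto
  have "unif_smooth n I (\<lambda>i x. u' i x * v i x + u i x * v' i x)"
    using u'(1) v'(1) Suc.prems[THEN unif_smooth_Suc_imp] by (intro unif_smooth_add Suc.IH)
  moreover have "\<forall>i\<in>I. \<forall>x. ((\<lambda>x. u i x * v i x) has_real_derivative u' i x * v i x + u i x * v' i x) (at x)"
    using u'(2) v'(2) by (auto intro!: derivative_eq_intros)
  ultimately show ?case
    using Suc.prems by (auto intro!: unif_periodic_mult exI[of _ "\<lambda>i x. u' i x * v i x + u i x * v' i x"])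
qed

lemma unif_smooth_trig:
  assumes "\<And>i. i \<in> I \<Longrightarrow> \<bar>a i\<bar> \<le> 1" "\<And>i. i \<in> I \<Longrightarrow> \<bar>b i\<bar> \<le> 1"
  shows "unif_smooth n I (\<lambda>i x. a i * cos x + b i * sin x)"
  using assms
proof (induction n arbitrary: a b)
  have per: "unif_periodic I (\<lambda>i x. a i * cos x + b i * sin x)"
    if ab: "\<And>i. i \<in> I \<Longrightarrow> \<bar>a i\<bar> \<le> 1" "\<And>i. i \<in> I \<Longrightarrow> \<bar>b i\<bar> \<le> 1" for a b :: "'a \<Rightarrow> real"
  proof -
    have "\<bar>a i * cos x + b i * sin x\<bar> \<le> 1 * 1 + 1 * 1" if "i \<in> I" for i x
      using that ab by (intro order_trans[OF abs_triangle_ineq] add_mono) (simp_all only: abs_mult, (intro mult_mono; simp)+)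
    then show ?thesis unfolding unif_periodic_def by (auto intro!: continuous_intros)
  qed
  {
    case 0 then show ?case by (simp add: per)
  next
    case (Suc n)
    have "unif_smooth n I (\<lambda>i x. b i * cos x + (- a i) * sin x)"
      by (rule Suc.IH) (use Suc.prems in auto)
    moreover have "\<forall>i\<in>I. \<forall>x. ((\<lambda>x. a i * cos x + b i * sin x) has_real_derivative b i * cos x + (- a i) * sin x) (at x)"
      by (auto intro!: derivative_eq_intros)
    moreover have "unif_periodic I (\<lambda>i x. a i * cos x + b i * sin x)"
      by (rule per) (use Suc.prems in auto)
    ultimately show ?case unfolding unif_smooth.simps by blast
  }
qed

text \<open>
  Integration by parts: the boundary terms cancel by periodicity, and each derivative gains a
  factor \<open>1/k\<close>. Sine and cosine are treated together because each step exchanges them.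
\<close>

lemma unif_smooth_fourier_decay:
  assumes "unif_smooth n I u"
  shows "\<exists>B. \<forall>i\<in>I. \<forall>k\<ge>1. \<bar>integral {-pi..pi} (\<lambda>x. u i x * sin (real k * x))\<bar> \<le> B / real k ^ n
     \<and> \<bar>integral {-pi..pi} (\<lambda>x. u i x * cos (real k * x))\<bar> \<le> B / real k ^ n"
  using assms
proof (induction n arbitrary: u)
  case 0
  then obtain B where B: "\<forall>i\<in>I. \<forall>x. \<bar>u i x\<bar> \<le> B" and c: "\<forall>i\<in>I. continuous_on UNIV (u i)"
    unfolding unif_smooth.simps unif_periodic_def by blast
  have bd: "\<bar>integral {-pi..pi} (\<lambda>x. u i x * w x)\<bar> \<le> B * (2 * pi)"
    if "i \<in> I" "continuous_on UNIV w" "\<And>x. \<bar>w x\<bar> \<le> 1" for i and w :: "real \<Rightarrow> real"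
  proof -
    have "norm (integral {-pi..pi} (\<lambda>x. u i x * w x)) \<le> (B * 1) * (pi - (- pi))"
    proof (rule integral_bound)
      show "continuous_on {-pi..pi} (\<lambda>x. u i x * w x)"
        using c that by (auto intro!: continuous_on_mult intro: continuous_on_subset)
      fix x
      have "0 \<le> \<bar>u i x\<bar>" by simp
      then have "0 \<le> B" using B that(1) order_trans by blast
      then show "norm (u i x * w x) \<le> B * 1"
        unfolding real_norm_def abs_mult using B that by (intro mult_mono) auto
    qed simp
    then show ?thesis by simp
  qed
  show ?case
    by (intro exI[of _ "B * (2 * pi)"]) (auto intro!: bd continuous_intros)
next
  case (Suc n)
  obtain u' where u': "unif_smooth n I u'" "\<forall>i\<in>I. \<forall>x. (u i has_real_derivative u' i x) (at x)"
    using Suc.prems by auto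
  obtain B where B: "\<forall>i\<in>I. \<forall>k\<ge>1. \<bar>integral {-pi..pi} (\<lambda>x. u' i x * sin (real k * x))\<bar> \<le> B / real k ^ n
     \<and> \<bar>integral {-pi..pi} (\<lambda>x. u' i x * cos (real k * x))\<bar> \<le> B / real k ^ n"
    using Suc.IH[OF u'(1)] by blast
  have "\<bar>integral {-pi..pi} (\<lambda>x. u i x * sin (real k * x))\<bar> \<le> B / real k ^ Suc n
     \<and> \<bar>integral {-pi..pi} (\<lambda>x. u i x * cos (real k * x))\<bar> \<le> B / real k ^ Suc n"
    if i: "i \<in> I" and k: "k \<ge> 1" for i k
  proof -
    have cu: "continuous_on S (u i)" and cu': "continuous_on S (u' i)" for S
      using unif_smooth_imp_periodic[OF Suc.prems] unif_smooth_imp_periodic[OF u'(1)] i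
      unfolding unif_periodic_def by (auto intro: continuous_on_subset)
    have d: "(u i has_real_derivative u' i x) (at x within S)" for x S
      using u'(2) i has_field_derivative_at_within by blast
    have "u i (- pi + 2 * pi) = u i (- pi)"
      using unif_smooth_imp_periodic[OF Suc.prems] i unfolding unif_periodic_def by blast
    then have per: "u i pi = u i (- pi)" by simp
    have "((\<lambda>x. u' i x * cos (real k * x) - real k * (u i x * sin (real k * x))) has_integral
        u i pi * cos (real k * pi) - u i (- pi) * cos (real k * (- pi))) {-pi..pi}"
    proof (rule fundamental_theorem_of_calculus)
      fix x
      have "((\<lambda>x. cos (real k * x)) has_real_derivative - sin (real k * x) * real k) (at x within {-pi..pi})"
        by (auto intro!: derivative_eq_intros)
      from DERIV_mult[OF d this] show "((\<lambda>x. u i x * cos (real k * x)) has_vector_derivative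
          u' i x * cos (real k * x) - real k * (u i x * sin (real k * x))) (at x within {-pi..pi})"
        by (simp add: has_real_derivative_iff_has_vector_derivative[symmetric] algebra_simps)
    qed simp
    then have "integral {-pi..pi} (\<lambda>x. u' i x * cos (real k * x) - real k * (u i x * sin (real k * x))) = 0"
      by (simp add: per integral_unique)
    moreover have "integral {-pi..pi} (\<lambda>x. u' i x * cos (real k * x) - real k * (u i x * sin (real k * x)))
      = integral {-pi..pi} (\<lambda>x. u' i x * cos (real k * x)) - integral {-pi..pi} (\<lambda>x. real k * (u i x * sin (real k * x)))"
      by (intro integral_diff integrable_continuous_real continuous_intros cu cu')
    ultimately have 1: "real k * integral {-pi..pi} (\<lambda>x. u i x * sin (real k * x)) = integral {-pi..pi} (\<lambda>x. u' i x * cos (real k * x))"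
      by simp
    have "((\<lambda>x. u' i x * sin (real k * x) + real k * (u i x * cos (real k * x))) has_integral
        u i pi * sin (real k * pi) - u i (- pi) * sin (real k * (- pi))) {-pi..pi}"
    proof (rule fundamental_theorem_of_calculus)
      fix x
      have "((\<lambda>x. sin (real k * x)) has_real_derivative cos (real k * x) * real k) (at x within {-pi..pi})"
        by (auto intro!: derivative_eq_intros)
      from DERIV_mult[OF d this] show "((\<lambda>x. u i x * sin (real k * x)) has_vector_derivative
          u' i x * sin (real k * x) + real k * (u i x * cos (real k * x))) (at x within {-pi..pi})"
        by (simp add: has_real_derivative_iff_has_vector_derivative[symmetric] algebra_simps)
    qed simp
    then have "integral {-pi..pi} (\<lambda>x. u' i x * sin (real k * x) + real k * (u i x * cos (real k * x))) = 0"
      by (simp add: per integral_unique)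
    moreover have "integral {-pi..pi} (\<lambda>x. u' i x * sin (real k * x) + real k * (u i x * cos (real k * x)))
      = integral {-pi..pi} (\<lambda>x. u' i x * sin (real k * x)) + integral {-pi..pi} (\<lambda>x. real k * (u i x * cos (real k * x)))"
      by (intro integral_add integrable_continuous_real continuous_intros cu cu')
    ultimately have 2: "real k * integral {-pi..pi} (\<lambda>x. u i x * cos (real k * x)) = - integral {-pi..pi} (\<lambda>x. u' i x * sin (real k * x))"
      by simp
    have *: "\<bar>x\<bar> \<le> B / real k ^ Suc n" if "\<bar>real k * x\<bar> \<le> B / real k ^ n" for x
    proof -
      have "\<bar>x\<bar> = \<bar>real k * x\<bar> / real k" using k by (simp add: abs_mult)
      also have "\<dots> \<le> (B / real k ^ n) / real k" using that k by (intro divide_right_mono) auto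
      finally show ?thesis by (simp add: mult.commute)
    qed
    show ?thesis
      by (intro conjI *; unfold 1 2 abs_minus_cancel) (use B i k in blast)+
  qed
  then show ?case by blast
qed

text \<open>
  The fundamental theorem of calculus tolerates an exceptional point, so \<open>u\<close> is near \<open>x0\<close> an
  integral of the continuous function \<open>v\<close>.
\<close>

lemma has_real_derivative_removable:
  fixes u v :: "real \<Rightarrow> real"
  assumes u: "continuous_on UNIV u" and v: "continuous_on UNIV v"
    and d: "\<And>x. x \<noteq> x0 \<Longrightarrow> \<bar>x - x0\<bar> < 1 \<Longrightarrow> (u has_real_derivative v x) (at x)"
  shows "(u has_real_derivative v x0) (at x0)"
proof -
  let ?a = "x0 - 1" and ?b = "x0 + 1"
  have int: "((\<lambda>x. u ?a + integral {?a..x} v) has_real_derivative v x0) (at x0 within {?a..?b})"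
  proof -
    have "((\<lambda>x. integral {?a..x} v) has_real_derivative v x0) (at x0 within {?a..?b})"
      by (rule integral_has_real_derivative[OF continuous_on_subset[OF v]]) auto
    from DERIV_add[OF DERIV_const this] show ?thesis by simp
  qed
  have eq: "u x = u ?a + integral {?a..x} v" if "x \<in> {?a..?b}" for x
  proof -
    have "(v has_integral u x - u ?a) {?a..x}"
    proof (rule fundamental_theorem_of_calculus_interior_strong[of "{x0}"])
      fix y assume "y \<in> {?a<..<x} - {x0}"
      then show "(u has_vector_derivative v y) (at y)"
        using d[of y] that by (auto simp: has_real_derivative_iff_has_vector_derivative)
    qed (use that u in \<open>auto intro: continuous_on_subset\<close>)
    then show ?thesis by (simp add: integral_unique)
  qed
  have "(u has_real_derivative v x0) (at x0 within {?a..?b})"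
    by (rule has_field_derivative_transform_within[OF int zero_less_one]) (simp, rule eq[symmetric])
  moreover have "at x0 within {?a..?b} = at x0" by (rule at_within_Icc_at) auto
  ultimately show ?thesis by (simp only:)
qed

lemma open_open_disk: "open open_disk"
proof -
  have eq: "open_disk = ball 0 1"
    by (auto simp: open_disk_def dist_norm norm_prod_def real_sqrt_lt_1_iff)
  show ?thesis unfolding eq by (rule open_ball)
qed

lemma open_disk_subset: "open_disk \<subseteq> disk"
  by (auto simp: open_disk_def disk_def)

lemma has_derivative_from_continuous_partials:
  fixes f g h :: "real \<times> real \<Rightarrow> real"
  assumes S: "open S" "(x, y) \<in> S" and h: "continuous_on S h"
    and fx: "((\<lambda>s. f (s, y)) has_real_derivative g (x, y)) (at x)"
    and fy: "\<And>x y. (x, y) \<in> S \<Longrightarrow> ((\<lambda>t. f (x, t)) has_real_derivative h (x, y)) (at y)"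
  shows "(f has_derivative (\<lambda>(s, t). g (x, y) * s + h (x, y) * t)) (at (x, y))"
proof -
  obtain A B where AB: "open A" "open B" "(x, y) \<in> A \<times> B" "A \<times> B \<subseteq> S"
    using S by (rule open_prod_elim)
  then obtain e where e: "e > 0" "ball y e \<subseteq> B" by (meson mem_Sigma_iff open_contains_ball)
  have sub: "A \<times> ball y e \<subseteq> S" using AB e by auto
  have "((\<lambda>(x, y). f (x, y)) has_derivative (\<lambda>(s, t). g (x, y) * s + blinfun_apply (h (x, y) *\<^sub>R id_blinfun) t))
     (at (x, y) within A \<times> ball y e)"
  proof (rule has_derivative_partialsI)
    show "((\<lambda>x. f (x, y)) has_derivative (\<lambda>s. g (x, y) * s)) (at x within A)"
      using fx by (simp add: has_field_derivative_def has_derivative_at_withinI)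
    fix a b assume "a \<in> A" "b \<in> ball y e"
    then have "((\<lambda>t. f (a, t)) has_real_derivative h (a, b)) (at b)" using sub by (intro fy) auto
    then show "((\<lambda>y. f (a, y)) has_derivative blinfun_apply (h (a, b) *\<^sub>R id_blinfun)) (at b within ball y e)"
      by (simp add: has_field_derivative_def has_derivative_at_withinI scaleR_blinfun.rep_eq)
  next
    have "continuous_on (A \<times> ball y e) (\<lambda>z. h z *\<^sub>R (id_blinfun :: real \<Rightarrow>\<^sub>L real))"
      by (intro continuous_intros continuous_on_subset[OF h sub])
    then show "continuous (at (x, y) within A \<times> ball y e) (\<lambda>(a, b). h (a, b) *\<^sub>R (id_blinfun :: real \<Rightarrow>\<^sub>L real))"
      using AB e by (simp add: continuous_on_eq_continuous_within split_def)
  qed (use e in auto)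
  moreover have "at (x, y) within A \<times> ball y e = at (x, y)"
    using AB e by (intro at_within_open) (auto intro: open_Times)
  ultimately show ?thesis by (simp add: scaleR_blinfun.rep_eq)
qed

lemma C_disk_imp_continuous: "C_disk n f \<Longrightarrow> continuous_on disk f"
  by (cases n) auto

text \<open>
  For \<open>\<bar>s\<bar> < 1\<close> the curve \<open>\<psi> \<mapsto> (cos \<psi>, s sin \<psi>)\<close> is an ellipse inside the disk that meets the
  boundary circle only where \<open>sin \<psi> = 0\<close>. Elsewhere the chain rule applies. Its result extends
  continuously to the exceptional points, because the partial derivatives do, and there
  \<open>has_real_derivative_removable\<close> applies.
\<close>

lemma C_disk_imp_unif_smooth:
  "C_disk n f \<Longrightarrow> unif_smooth n (UNIV \<times> {-1<..<1}) (\<lambda>(\<phi>, s) \<psi>. f (line_point \<phi> (cos \<psi>) (s * sin \<psi>)))"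
proof (induction n arbitrary: f)
  have per: "unif_periodic (UNIV \<times> {-1<..<1}) (\<lambda>(\<phi>, s) \<psi>. f (line_point \<phi> (cos \<psi>) (s * sin \<psi>)))"
    if f: "continuous_on disk f" for f
  proof -
    obtain B where B: "\<And>x. x \<in> disk \<Longrightarrow> \<bar>f x\<bar> \<le> B"
      using compact_imp_bounded[OF compact_continuous_image[OF f compact_disk]]
      by (force simp: bounded_iff)
    have "continuous_on UNIV (\<lambda>\<psi>. f (line_point \<phi> (cos \<psi>) (s * sin \<psi>)))" if "s \<in> {-1<..<1}" for \<phi> s
    proof (rule continuous_on_compose2[OF f])
      show "continuous_on UNIV (\<lambda>\<psi>. line_point \<phi> (cos \<psi>) (s * sin \<psi>))"
        unfolding line_point_def by (intro continuous_intros)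
    qed (use that in \<open>auto intro!: line_point_in_disk\<close>)
    then show ?thesis
      unfolding unif_periodic_def by (auto intro!: exI[of _ B] B line_point_in_disk)
  qed
  {
    case 0 then show ?case by (simp add: per)
  next
    case (Suc n)
    obtain g h where g: "C_disk n g" and h: "C_disk n h"
      and fx: "\<And>x y. (x, y) \<in> open_disk \<Longrightarrow> ((\<lambda>s. f (s, y)) has_real_derivative g (x, y)) (at x)"
      and fy: "\<And>x y. (x, y) \<in> open_disk \<Longrightarrow> ((\<lambda>t. f (x, t)) has_real_derivative h (x, y)) (at y)"
    proof -
      from Suc.prems obtain g h where gh: "C_disk n g" "C_disk n h"
        "\<forall>(x, y)\<in>open_disk. ((\<lambda>s. f (s, y)) has_real_derivative g (x, y)) (at x) \<and>
           ((\<lambda>t. f (x, t)) has_real_derivative h (x, y)) (at y)"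
        unfolding C_disk.simps by blast
      show thesis by (rule that[OF gh(1,2)]) (use gh(3) in \<open>auto dest!: bspec\<close>)
    qed
    let ?I = "UNIV \<times> {-1<..<1} :: (real \<times> real) set"
    define u where "u = (\<lambda>(\<phi>, s) \<psi>. f (line_point \<phi> (cos \<psi>) (s * sin \<psi>)))"
    define u' where "u' = (\<lambda>i \<psi>. (\<lambda>(\<phi>, s) \<psi>. g (line_point \<phi> (cos \<psi>) (s * sin \<psi>))) i \<psi> *
          ((- snd i * sin (fst i)) * cos \<psi> + (- cos (fst i)) * sin \<psi>) +
        (\<lambda>(\<phi>, s) \<psi>. h (line_point \<phi> (cos \<psi>) (s * sin \<psi>))) i \<psi> *
          ((snd i * cos (fst i)) * cos \<psi> + (- sin (fst i)) * sin \<psi>))"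
    have le: "\<bar>s * c\<bar> \<le> 1" if "s \<in> {-1<..<1}" "\<bar>c\<bar> \<le> 1" for s c :: real
      unfolding abs_mult using that by (intro mult_le_one) auto
    have u'_smooth: "unif_smooth n ?I u'"
      unfolding u'_def
      by (intro unif_smooth_add unif_smooth_mult Suc.IH g h unif_smooth_trig)
         (auto simp: le)
    have cu: "continuous_on UNIV (u i)" and cu': "continuous_on UNIV (u' i)" if "i \<in> ?I" for i
      using per[OF C_disk_imp_continuous[OF Suc.prems]] unif_smooth_imp_periodic[OF u'_smooth] that
      unfolding u_def unif_periodic_def by blast+
    have d_inner: "(u i has_real_derivative u' i \<psi>) (at \<psi>)" if i: "i \<in> ?I" and sn: "sin \<psi> \<noteq> 0" for i \<psi>
    proof -
      obtain \<phi> s where ieq: "i = (\<phi>, s)" by (cases i)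
      define P where "P = line_point \<phi> (cos \<psi>) (s * sin \<psi>)"
      have s: "s\<^sup>2 < 1" using i ieq by (auto simp: abs_square_less_1 abs_less_iff)
      have "s\<^sup>2 * (sin \<psi>)\<^sup>2 < 1 * (sin \<psi>)\<^sup>2" using s sn by (intro mult_strict_right_mono) auto
      then have "(cos \<psi>)\<^sup>2 + (s * sin \<psi>)\<^sup>2 < 1"
        using sin_cos_squared_add[of \<psi>] unfolding power_mult_distrib by linarith
      then have P: "(fst P, snd P) \<in> open_disk"
        using line_point_norm[of \<phi> "cos \<psi>" "s * sin \<psi>"] by (simp add: open_disk_def P_def case_prod_beta)
      have fd: "(f has_derivative (\<lambda>(s, t). g (fst P, snd P) * s + h (fst P, snd P) * t)) (at (fst P, snd P))"
        by (rule has_derivative_from_continuous_partials[where f = f and g = g and h = h, OF open_open_disk P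
              continuous_on_subset[OF C_disk_imp_continuous[OF h] open_disk_subset] fx[OF P] fy])
      have "((\<lambda>\<psi>. line_point \<phi> (cos \<psi>) (s * sin \<psi>)) has_derivative
         (\<lambda>t. (((- s * sin \<phi>) * cos \<psi> + (- cos \<phi>) * sin \<psi>) * t, ((s * cos \<phi>) * cos \<psi> + (- sin \<phi>) * sin \<psi>) * t))) (at \<psi>)"
        unfolding line_point_def
        by (auto intro!: derivative_eq_intros simp: algebra_simps)
      from has_derivative_compose[OF this, of f, folded P_def, OF fd[unfolded prod.collapse]]
      have "((\<lambda>\<psi>. f (line_point \<phi> (cos \<psi>) (s * sin \<psi>))) has_derivative
        (\<lambda>t. g P * (((- s * sin \<phi>) * cos \<psi> + (- cos \<phi>) * sin \<psi>) * t) + h P * (((s * cos \<phi>) * cos \<psi> + (- sin \<phi>) * sin \<psi>) * t))) (at \<psi>)"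
        by simp
      moreover have "(\<lambda>t. g P * (((- s * sin \<phi>) * cos \<psi> + (- cos \<phi>) * sin \<psi>) * t) + h P * (((s * cos \<phi>) * cos \<psi> + (- sin \<phi>) * sin \<psi>) * t))
        = (*) (u' i \<psi>)"
        by (simp add: fun_eq_iff u'_def ieq P_def distrib_right mult.assoc)
      ultimately show ?thesis
        by (simp add: has_field_derivative_def u_def ieq)
    qed
    have "(u i has_real_derivative u' i \<psi>) (at \<psi>)" if i: "i \<in> ?I" for i \<psi>
    proof (cases "sin \<psi> = 0")
      case True
      show ?thesis
      proof (rule has_real_derivative_removable[OF cu[OF i] cu'[OF i]])
        fix x assume x: "x \<noteq> \<psi>" "\<bar>x - \<psi>\<bar> < 1"
        have "sin x \<noteq> 0"
        proof
          assume "sin x = 0"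
          then have "sin (x - \<psi>) = 0" using True by (simp add: sin_diff)
          then have "sin \<bar>x - \<psi>\<bar> = 0" by (auto simp: abs_if sin_diff mult.commute)
          moreover have "sin \<bar>x - \<psi>\<bar> > 0" using x pi_gt3 by (intro sin_gt_zero) auto
          ultimately show False by simp
        qed
        then show "(u i has_real_derivative u' i x) (at x)" by (rule d_inner[OF i])
      qed
    qed (rule d_inner[OF i])
    then have "unif_smooth (Suc n) ?I u"
      using u'_smooth per[OF C_disk_imp_continuous[OF Suc.prems]] unfolding u_def unif_smooth.simps by blast
    then show ?case unfolding u_def .
  }
qed

lemma chord_int_minus: "chord_int F \<phi> (- \<psi>) = chord_int F \<phi> \<psi>"
  using Henstock_Kurzweil_Integration.integral_reflect_real[of 1 "-1" "\<lambda>s. F (line_point \<phi> (cos \<psi>) (s * sin \<psi>))"]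
  by (simp add: chord_int_def)

text \<open>
  The coefficient is half of an integral over a full period, since \<open>chord_int\<close> is even in \<open>\<psi>\<close>.
  Exchanging the two integrations gives, for each \<open>s\<close>, a Fourier coefficient of a smooth periodic
  function of \<open>\<psi>\<close>; the bounds are uniform in \<open>s\<close> and \<open>\<phi>\<close>.
\<close>

theorem C_disk_radon_coeff_decay:
  assumes "C_disk p f"
  obtains C where "C \<ge> 0" "\<And>n \<phi>. \<bar>radon_coeff f n \<phi>\<bar> \<le> C / (real n + 1) ^ p"
proof -
  let ?I = "UNIV \<times> {-1<..<1} :: (real \<times> real) set"
  have f: "continuous_on disk f" using assms by (rule C_disk_imp_continuous)
  have "unif_smooth p ?I (\<lambda>i \<psi>. (\<lambda>(\<phi>, s) \<psi>. f (line_point \<phi> (cos \<psi>) (s * sin \<psi>))) i \<psi> * (0 * cos \<psi> + 1 * sin \<psi>))"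
    by (intro unif_smooth_mult unif_smooth_trig C_disk_imp_unif_smooth assms) auto
  from unif_smooth_fourier_decay[OF this] obtain B where
    B: "\<And>\<phi> s k. s \<in> {-1<..<1} \<Longrightarrow> k \<ge> 1 \<Longrightarrow>
     \<bar>integral {-pi..pi} (\<lambda>\<psi>. f (line_point \<phi> (cos \<psi>) (s * sin \<psi>)) * sin \<psi> * sin (real k * \<psi>))\<bar> \<le> B / real k ^ p"
    by fastforce
  have "\<bar>integral {-pi..pi} (\<lambda>\<psi>. f (line_point 0 (cos \<psi>) (0 * sin \<psi>)) * sin \<psi> * sin (real 1 * \<psi>))\<bar> \<le> B / real 1 ^ p"
    by (rule B) auto
  then have B0: "B \<ge> 0" by simp
  have "\<bar>radon_coeff f n \<phi>\<bar> \<le> (2 * B / pi) / (real n + 1) ^ p" for n \<phi>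
  proof -
    define k where "k = Suc n"
    define A where "A = (\<lambda>\<psi> s. f (line_point \<phi> (cos \<psi>) (s * sin \<psi>)) * sin \<psi> * sin (real k * \<psi>))"
    define H where "H = (\<lambda>\<psi>. (sin (real k * \<psi>) * sin \<psi>) * chord_int f \<phi> \<psi>)"
    have cH: "continuous_on S H" for S
      unfolding H_def by (intro continuous_intros continuous_on_chord_int f)
    have "integral {-pi..pi} H = integral {-pi..0} H + integral {0..pi} H"
      by (rule Henstock_Kurzweil_Integration.integral_combine[symmetric]) (auto intro!: integrable_continuous_real cH)
    also have "integral {-pi..0} H = integral {0..pi} H"
      using Henstock_Kurzweil_Integration.integral_reflect_real[of pi 0 H] by (simp add: H_def chord_int_minus)
    finally have half: "integral {0..pi} H = integral {-pi..pi} H / 2" by simp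
    have HA: "H \<psi> = integral (cbox (-1) 1) (A \<psi>)" for \<psi>
      by (simp add: H_def A_def chord_int_def mult_ac flip: integral_mult_right)
    have cA: "continuous_on (cbox (-pi, -1) (pi, 1)) (\<lambda>(\<psi>, s). A \<psi> s)"
    proof -
      have "continuous_on ({-pi..pi} \<times> {-1..1}) (\<lambda>z. (\<lambda>(\<psi>, s). f (line_point \<phi> (cos \<psi>) (s * sin \<psi>))) z * sin (fst z) * sin (real k * fst z))"
        by (intro continuous_intros continuous_on_chord_param f)
      then show ?thesis by (simp add: A_def case_prod_beta cbox_Pair_eq)
    qed
    have "integral {-pi..pi} H = integral (cbox (-pi) pi) (\<lambda>\<psi>. integral (cbox (-1) 1) (A \<psi>))"
      by (simp add: HA[abs_def])
    also have "\<dots> = integral (cbox (-1) 1) (\<lambda>s. integral (cbox (-pi) pi) (\<lambda>\<psi>. A \<psi> s))"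
      by (rule integral_swap_continuous[OF cA])
    finally have sw: "integral {-pi..pi} H = integral {-1..1} (\<lambda>s. integral {-pi..pi} (\<lambda>\<psi>. A \<psi> s))" by simp
    have "continuous_on (cbox (-1) 1) (\<lambda>s. integral (cbox (-pi) pi) (\<lambda>\<psi>. A \<psi> s))"
    proof (rule integral_continuous_on_param)
      have "continuous_on (cbox (-1) 1 \<times> cbox (-pi) pi) (\<lambda>z. (\<lambda>(\<psi>, s). A \<psi> s) (snd z, fst z))"
        by (rule continuous_on_compose2[OF cA]) (auto intro!: continuous_intros simp: cbox_Pair_eq)
      then show "continuous_on (cbox (-1) 1 \<times> cbox (-pi) pi) (\<lambda>(s, \<psi>). A \<psi> s)"
        by (simp add: case_prod_beta)
    qed
    then have int: "((\<lambda>s. integral {-pi..pi} (\<lambda>\<psi>. A \<psi> s)) has_integral integral {-1..1} (\<lambda>s. integral {-pi..pi} (\<lambda>\<psi>. A \<psi> s))) {-1..1}"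
      by (intro integrable_integral integrable_continuous_real) simp
    have "norm (integral {-1..1} (\<lambda>s. integral {-pi..pi} (\<lambda>\<psi>. A \<psi> s))) \<le> (B / real k ^ p) * measure lborel {-1..1::real}"
      \<comment> \<open>The end points are exceptional: for \<open>\<bar>s\<bar> = 1\<close> the curve runs in the boundary circle.\<close>
      by (rule has_integral_bound_real[OF _ _ int, of _ "{-1, 1}"])
         (use B[of _ k \<phi>] B0 in \<open>auto simp: A_def k_def\<close>)
    then have "\<bar>integral {0..pi} H\<bar> \<le> B / real k ^ p"
      unfolding half sw by simp
    then have "2 / pi * \<bar>integral {0..pi} H\<bar> \<le> 2 / pi * (B / real k ^ p)"
      by (intro mult_left_mono) auto
    then show ?thesis
      by (simp add: radon_coeff_def H_def k_def abs_mult add.commute)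
  qed
  then show ?thesis using B0 by (intro that[of "2 * B / pi"]) auto
qed

section \<open>The discrete inversion formula\<close>

text \<open>
  The component of degree \<open>n\<close> in the expansion of \<open>F\<close> in orthogonal polynomials on the disk,
  written as a sum over the smallest admissible set of \<open>2n + 1\<close> angles. By
  \<open>radon_proj_discrete\<close> any larger odd number of angles gives the same function.
\<close>

definition radon_proj :: "(real \<times> real \<Rightarrow> real) \<Rightarrow> nat \<Rightarrow> real \<times> real \<Rightarrow> real" where
  "radon_proj F n x = (real n + 1) / (2 * (2 * real n + 1)) *
     (\<Sum>\<nu>=0..2*n. radon_coeff F n (phi n \<nu>) * cheb_U n (coord (phi n \<nu>) x))"

text \<open>
  The double sum \<open>S\<close> over both sets of angles can be evaluated in either order: the reproducing
  property of \<open>b\<^sub>n\<close> on the angles \<open>phi n\<close> eliminates these, and that of the ridge function on the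
  angles \<open>phi m\<close> eliminates those.
\<close>

lemma radon_proj_discrete:
  assumes F: "continuous_on disk F" and nm: "n \<le> 2 * m"
  shows "radon_proj F n x = (real n + 1) / (2 * (2 * real m + 1)) *
     (\<Sum>\<nu>=0..2*m. radon_coeff F n (phi m \<nu>) * cheb_U n (coord (phi m \<nu>) x))"
proof -
  let ?b = "radon_coeff F n" and ?U = "cheb_U n"
  define S where "S = (\<Sum>\<nu>=0..2*m. \<Sum>\<mu>=0..2*n. ?b (phi n \<mu>) * ?U (cos (phi n \<mu> - phi m \<nu>)) * ?U (coord (phi m \<nu>) x))"
  have "S = (\<Sum>\<nu>=0..2*m. (2 * real n + 1) * (?b (phi m \<nu>) * ?U (coord (phi m \<nu>) x)))"
    unfolding S_def sum_distrib_right[symmetric]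
    by (subst radon_coeff_reproducing[OF F]) (simp_all add: mult_ac)
  then have 1: "S = (2 * real n + 1) * (\<Sum>\<nu>=0..2*m. ?b (phi m \<nu>) * ?U (coord (phi m \<nu>) x))"
    by (simp only: sum_distrib_left)
  have cosd: "cos (a - b) = cos (b - a)" for a b :: real
    using cos_minus[of "a - b"] by simp
  have "S = (\<Sum>\<mu>=0..2*n. ?b (phi n \<mu>) * (\<Sum>\<nu>=0..2*m. ?U (coord (phi m \<nu>) x) * ?U (cos (phi m \<nu> - phi n \<mu>))))"
    unfolding S_def sum_distrib_left
    by (subst sum.swap, intro sum.cong refl) (simp add: cosd mult_ac)
  also have "\<dots> = (\<Sum>\<mu>=0..2*n. (2 * real m + 1) * (?b (phi n \<mu>) * ?U (coord (phi n \<mu>) x)))"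
    unfolding ridge_reproducing[OF nm] by (simp add: mult_ac)
  finally have 2: "S = (2 * real m + 1) * (\<Sum>\<mu>=0..2*n. ?b (phi n \<mu>) * ?U (coord (phi n \<mu>) x))"
    by (simp only: sum_distrib_left)
  define A B where "A = (\<Sum>\<nu>=0..2*m. ?b (phi m \<nu>) * ?U (coord (phi m \<nu>) x))"
    and "B = (\<Sum>\<mu>=0..2*n. ?b (phi n \<mu>) * ?U (coord (phi n \<mu>) x))"
  have "(2 * real n + 1) * A = (2 * real m + 1) * B" using 1 2 by (simp add: A_def B_def)
  then have "B / (2 * real n + 1) = A / (2 * real m + 1)"
    by (simp add: frac_eq_eq mult_ac)
  moreover have "radon_proj F n x = (real n + 1) / 2 * (B / (2 * real n + 1))"
    by (simp add: radon_proj_def B_def)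
  ultimately show ?thesis by (simp add: A_def)
qed

lemma continuous_on_radon_proj: "continuous_on S (radon_proj F n)"
  unfolding radon_proj_def[abs_def]
  by (intro continuous_intros continuous_on_subset[OF continuous_on_id]) auto

lemma abs_radon_proj_le:
  assumes b: "\<And>\<phi>. \<bar>radon_coeff F n \<phi>\<bar> \<le> B" and x: "x \<in> disk"
  shows "\<bar>radon_proj F n x\<bar> \<le> (real n + 1)\<^sup>2 / 2 * B"
proof -
  have "0 \<le> \<bar>radon_coeff F n 0\<bar>" by simp
  also have "\<dots> \<le> B" by (rule b)
  finally have B: "0 \<le> B" .
  have "\<bar>\<Sum>\<nu>=0..2*n. radon_coeff F n (phi n \<nu>) * cheb_U n (coord (phi n \<nu>) x)\<bar>
     \<le> (\<Sum>\<nu>=0..2*n. B * (real n + 1))"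
    by (intro order_trans[OF sum_abs] sum_mono, unfold abs_mult)
       (intro mult_mono b abs_cheb_U_le abs_coord_le_1 x B; simp)
  then have "\<bar>radon_proj F n x\<bar> \<le> (real n + 1) / (2 * (2 * real n + 1)) * (\<Sum>\<nu>=0..2*n. B * (real n + 1))"
    unfolding radon_proj_def abs_mult by (intro mult_mono) auto
  also have "(\<Sum>\<nu>=0..2*n. B * (real n + 1)) = (2 * real n + 1) * (B * (real n + 1))" by simp
  also have "(real n + 1) / (2 * (2 * real n + 1)) * ((2 * real n + 1) * (B * (real n + 1))) = (real n + 1)\<^sup>2 / 2 * B"
    by (simp add: power2_eq_square field_simps)
  finally show ?thesis .
qed

lemma chord_int_radon_proj:
  assumes F: "continuous_on disk F"
  shows "sin \<psi> * chord_int (radon_proj F n) \<phi> \<psi> = radon_coeff F n \<phi> * sin ((real n + 1) * \<psi>)"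
proof -
  have L: "sup_functional (\<lambda>F. sin \<psi> * chord_int F \<phi> \<psi>)"
    by (intro sup_functional_scaled sup_functional_chord_int)
  have c: "continuous_on disk (\<lambda>x. cheb_U n (coord \<eta> x))" for \<eta>
    by (intro continuous_intros)
  have "sin \<psi> * chord_int (radon_proj F n) \<phi> \<psi> = (real n + 1) / (2 * (2 * real n + 1)) *
     (\<Sum>\<nu>=0..2*n. radon_coeff F n (phi n \<nu>) * (sin \<psi> * chord_int (\<lambda>x. cheb_U n (coord (phi n \<nu>) x)) \<phi> \<psi>))"
    unfolding radon_proj_def[abs_def]
    by (simp only: sup_functional_scale[OF L] sup_functional_sum[OF L] c continuous_on_sum
        continuous_on_mult_left finite_atLeastAtMost)
  also have "\<dots> = (real n + 1) / (2 * (2 * real n + 1)) * (2 / (real n + 1) * sin ((real n + 1) * \<psi>)) *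
     (\<Sum>\<nu>=0..2*n. radon_coeff F n (phi n \<nu>) * cheb_U n (cos (phi n \<nu> - \<phi>)))"
    unfolding chord_int_ridge sum_distrib_left by (intro sum.cong refl) (simp add: mult_ac)
  also have "\<dots> = (real n + 1) / (2 * (2 * real n + 1)) * (2 / (real n + 1) * sin ((real n + 1) * \<psi>)) * ((2 * real n + 1) * radon_coeff F n \<phi>)"
    by (subst radon_coeff_reproducing[OF F]) simp_all
  also have "\<dots> = radon_coeff F n \<phi> * sin ((real n + 1) * \<psi>)"
  proof -
    have cancel: "a / (2 * d) * (2 / a * t) * (d * b) = b * t" if "a \<noteq> 0" "d \<noteq> 0" for a b d t :: real
      using that by simp
    show ?thesis by (rule cancel; linarith)
  qed
  finally show ?thesis .
qed

lemma radon_coeff_radon_proj: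
  assumes F: "continuous_on disk F"
  shows "radon_coeff (radon_proj F k) n \<phi> = (if k = n then radon_coeff F n \<phi> else 0)"
proof -
  have "(sin ((real n + 1) * \<psi>) * sin \<psi>) * chord_int (radon_proj F k) \<phi> \<psi>
    = radon_coeff F k \<phi> * (sin ((real k + 1) * \<psi>) * sin ((real n + 1) * \<psi>))" for \<psi>
    unfolding mult.assoc chord_int_radon_proj[OF F] by (simp add: mult_ac)
  then have "radon_coeff (radon_proj F k) n \<phi> = 2 / pi * (radon_coeff F k \<phi> * (if k = n then pi / 2 else 0))"
    by (simp only: radon_coeff_def[of "radon_proj F k"] integral_mult_right integral_sin_sin)
  then show ?thesis by simp
qed

lemma summable_inverse_squares: "summable (\<lambda>n. C * (1 / (real n + 1)\<^sup>2))"
  using sums_summable[OF inverse_squares_sums] by (intro summable_mult) (simp add: add.commute)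

text \<open>
  The bound \<open>\<bar>U\<^sub>n\<bar> \<le> n + 1\<close> on \<open>[-1, 1]\<close> and the decay of the coefficients make the series
  converge uniformly on the closed disk. Its sum is continuous and has the same coefficients
  as \<open>F\<close>, so uniqueness identifies it with \<open>F\<close>.
\<close>

theorem radon_expansion:
  assumes F: "continuous_on disk F" and decay: "\<And>n \<phi>. \<bar>radon_coeff F n \<phi>\<bar> \<le> C / (real n + 1) ^ 4"
  shows "uniform_limit disk (\<lambda>N x. \<Sum>n<N. radon_proj F n x) F sequentially"
proof -
  define G where "G = (\<lambda>x. \<Sum>n. radon_proj F n x)"
  have bd: "norm (radon_proj F n x) \<le> C / 2 * (1 / (real n + 1)\<^sup>2)" if "x \<in> disk" for n x
  proof -
    have "(real n + 1)\<^sup>2 / 2 * (C / (real n + 1) ^ 4) = C / 2 * (1 / (real n + 1)\<^sup>2)"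
    proof -
      have "a\<^sup>2 / 2 * (C / a ^ 4) = C / 2 * (1 / a\<^sup>2)" if "a \<noteq> 0" for a :: real
        using that by (simp add: power2_eq_square power4_eq_xxxx)
      then show ?thesis by (metis of_nat_Suc add.commute nat.simps(3) of_nat_eq_0_iff)
    qed
    then show ?thesis using abs_radon_proj_le[OF decay that, of n] by simp
  qed
  have G: "uniform_limit disk (\<lambda>N x. \<Sum>n<N. radon_proj F n x) G sequentially"
    unfolding G_def by (rule Weierstrass_m_test[OF bd summable_inverse_squares])
  have contG: "continuous_on disk G"
    by (rule uniform_limit_theorem[OF _ G]) (intro always_eventually allI continuous_on_sum continuous_on_radon_proj, simp)
  have coeffG: "radon_coeff G n \<phi> = radon_coeff F n \<phi>" for n \<phi>
  proof -
    have "(\<lambda>k. radon_coeff (radon_proj F k) n \<phi>) sums radon_coeff G n \<phi>"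
      by (rule sup_functional_sums[OF sup_functional_radon_coeff continuous_on_radon_proj G])
    moreover have "(\<lambda>k. if k = n then radon_coeff F n \<phi> else 0) sums radon_coeff F n \<phi>"
      using sums_single[of n "\<lambda>_. radon_coeff F n \<phi>"] by simp
    ultimately show ?thesis unfolding radon_coeff_radon_proj[OF F] by (rule sums_unique2)
  qed
  have "F x - G x = 0" if "x \<in> disk" for x
  proof (rule radon_coeff_zero_imp_zero[OF _ _ that])
    show "continuous_on disk (\<lambda>x. F x - G x)" by (intro continuous_intros F contG)
    show "radon_coeff (\<lambda>x. F x - G x) n \<eta> = 0" for n \<eta>
      using sup_functional_diff[OF sup_functional_radon_coeff F contG] coeffG by simp
  qed
  then have "F x = G x" if "x \<in> disk" for x using that by simp
  then show ?thesis using G uniform_limit_cong'[of disk _ _ G F] by (metis (no_types, lifting))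
qed

text \<open>
  The inversion formula yields pointwise convergence of the sine series: integrate
  \<open>radon_expansion\<close> over a chord, where each component contributes one sine term.
\<close>

lemma chord_int_sine_series:
  assumes F: "continuous_on disk F" and decay: "\<And>n \<phi>. \<bar>radon_coeff F n \<phi>\<bar> \<le> C / (real n + 1) ^ 4"
  shows "(\<lambda>n. radon_coeff F n \<phi> * sin ((real n + 1) * \<psi>)) sums (sin \<psi> * chord_int F \<phi> \<psi>)"
  using sup_functional_sums[OF sup_functional_scaled[OF sup_functional_chord_int[of \<phi> \<psi>], of "sin \<psi>"]
      continuous_on_radon_proj radon_expansion[OF F decay]]
  by (simp only: chord_int_radon_proj[OF F])

lemma radon_eq_chord_int:
  assumes \<psi>: "0 < \<psi>" "\<psi> < pi"
  shows "radon f \<phi> (cos \<psi>) = sin \<psi> * chord_int f \<phi> \<psi>"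
proof -
  have s: "sin \<psi> > 0" using \<psi> by (rule sin_gt_zero)
  have "line_point \<phi> (cos \<psi>) s \<in> chord \<phi> (cos \<psi>) \<longleftrightarrow> s \<in> {- sin \<psi>..sin \<psi>}" for s
  proof -
    have "line_point \<phi> (cos \<psi>) s \<in> chord \<phi> (cos \<psi>) \<longleftrightarrow> (cos \<psi>)\<^sup>2 + s\<^sup>2 \<le> 1"
      using coord_line_point[of \<phi> \<phi> "cos \<psi>" s] line_point_norm[of \<phi> "cos \<psi>" s]
      by (simp add: chord_def disk_def case_prod_beta coord_def)
    also have "\<dots> \<longleftrightarrow> s\<^sup>2 \<le> (sin \<psi>)\<^sup>2"
      using sin_cos_squared_add[of \<psi>] by linarith
    also have "\<dots> \<longleftrightarrow> s \<in> {- sin \<psi>..sin \<psi>}"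
      using \<open>sin \<psi> > 0\<close> by (auto simp: abs_le_square_iff[symmetric] abs_le_iff)
    finally show ?thesis .
  qed
  then have set: "line_point \<phi> (cos \<psi>) -` chord \<phi> (cos \<psi>) = {- sin \<psi>..sin \<psi>}"
    by (intro set_eqI) (simp only: vimage_eq)
  have img: "(\<lambda>x. x / sin \<psi>) ` {- sin \<psi>..sin \<psi>} = {-1..1}"
    using s by (subst image_divide_atLeastAtMost) auto
  show ?thesis
    using integral_stretch_real[of "sin \<psi>" "- sin \<psi>" "sin \<psi>" "\<lambda>s. f (line_point \<phi> (cos \<psi>) s)"] s
    by (simp add: radon_def set chord_int_def img mult.commute)
qed

section \<open>Sampling and interpolation errors\<close>

text \<open>
  Compare with the telescoping series of \<open>1/n - 1/(n + 1)\<close>.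
\<close>

lemma inverse_square_tail:
  assumes "a sums s" "N \<ge> 1" "C \<ge> 0" "\<And>n. n \<ge> N \<Longrightarrow> \<bar>a n\<bar> \<le> C / (real n + 1)\<^sup>2"
  shows "\<bar>s - (\<Sum>n<N. a n)\<bar> \<le> C / real N"
proof -
  have tele: "\<bar>(\<Sum>n<L. a n) - (\<Sum>n<N. a n)\<bar> \<le> C * (1 / real N - 1 / real L)" if "L \<ge> N" for L
    using that
  proof (induction L rule: dec_induct)
    case (step L)
    have L: "real L > 0" using step \<open>N \<ge> 1\<close> by simp
    have "1 / (real L + 1)\<^sup>2 \<le> 1 / (real L * (real L + 1))"
      using L by (intro divide_left_mono) (auto simp: power2_eq_square)
    also have "\<dots> = 1 / real L - 1 / real (Suc L)" using L by (simp add: field_simps)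
    finally have "C * (1 / (real L + 1)\<^sup>2) \<le> C * (1 / real L - 1 / real (Suc L))"
      using \<open>C \<ge> 0\<close> by (rule mult_left_mono)
    then have "\<bar>a L\<bar> \<le> C * (1 / real L - 1 / real (Suc L))"
      using assms(4)[OF step(1)] by simp
    with step.IH show ?case by (simp add: right_diff_distrib)
  qed simp
  have "(\<lambda>L. \<bar>(\<Sum>n<L. a n) - (\<Sum>n<N. a n)\<bar>) \<longlonglongrightarrow> \<bar>s - (\<Sum>n<N. a n)\<bar>"
    using assms(1) unfolding sums_def by (intro tendsto_intros)
  moreover have "\<bar>(\<Sum>n<L. a n) - (\<Sum>n<N. a n)\<bar> \<le> C / real N" if "L \<ge> N" for L
  proof -
    have "0 \<le> C / real L" using \<open>C \<ge> 0\<close> by simp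
    then show ?thesis using tele[OF that] by (simp add: right_diff_distrib)
  qed
  ultimately show ?thesis by (intro LIMSEQ_le_const2) auto
qed

lemma sum_inverse_squares_le: "(\<Sum>k=0..n. 1 / (real k + 1)\<^sup>2) \<le> 2"
proof -
  have "(\<Sum>k=0..n. 1 / (real k + 1)\<^sup>2) \<le> 2 - 1 / (real n + 1)"
  proof (induction n)
    case (Suc n)
    have "1 / (real n + 2)\<^sup>2 \<le> 1 / ((real n + 1) * (real n + 2))"
      by (intro divide_left_mono) (auto simp: power2_eq_square)
    also have "\<dots> = 1 / (real n + 1) - 1 / (real n + 2)" by (simp add: field_simps)
    finally show ?case using Suc by (simp add: algebra_simps)
  qed simp
  also have "\<dots> \<le> 2" by simp
  finally show ?thesis .
qed

lemma psi_bounds: assumes "j \<le> 2 * m" shows "0 < psi m j" "psi m j < pi"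
proof -
  have "2 * real j + 1 < 4 * real m + 2" using assms by linarith
  then show "psi m j < pi" by (simp add: psi_def divide_less_eq)
  show "0 < psi m j" by (simp add: psi_def zero_less_divide_iff add_pos_nonneg)
qed

lemma sum_cos_psi_eq_0:
  assumes "p \<noteq> 0" "\<bar>p\<bar> < 4 * int m + 2"
  shows "(\<Sum>j=0..2*m. cos (of_int p * psi m j)) = 0"
proof -
  define a where "a = of_int p * pi / (4 * real m + 2)"
  have mid: "of_int p * psi m j = (2 * real j + 1) * a" for j
    by (simp add: psi_def a_def)
  have tele: "2 * sin a * (\<Sum>j<n. cos ((2 * real j + 1) * a)) = sin (2 * real n * a)" for n
  proof (induction n)
    case (Suc n)
    have "2 * sin a * cos ((2 * real n + 1) * a) = sin (2 * real (Suc n) * a) - sin (2 * real n * a)"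
      unfolding sin_diff_sin by (simp add: algebra_simps add_divide_distrib diff_divide_distrib)
    with Suc show ?case by (simp add: distrib_left)
  qed simp
  have "sin a \<noteq> 0"
  proof -
    have "\<bar>real_of_int p\<bar> < 4 * real m + 2" using assms(2) by linarith
    then have "\<bar>a\<bar> < pi" by (simp add: a_def abs_mult divide_less_eq)
    moreover have "\<bar>a\<bar> > 0" using assms(1) by (simp add: a_def)
    ultimately have "sin \<bar>a\<bar> > 0" by (intro sin_gt_zero)
    then show ?thesis by (auto simp: abs_if split: if_splits)
  qed
  moreover have "2 * real (Suc (2 * m)) * a = pi * of_int p"
  proof -
    have "2 * real (Suc (2 * m)) = 4 * real m + 2" "4 * real m + 2 \<noteq> 0" by simp_all
    then show ?thesis by (simp add: a_def mult.commute del: of_nat_Suc of_nat_mult)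
  qed
  then have "sin (2 * real (Suc (2 * m)) * a) = 0" by (simp only: sin_npi_int)
  then have "2 * sin a * (\<Sum>j<Suc (2 * m). cos ((2 * real j + 1) * a)) = 0"
    by (simp only: tele)
  moreover have "(2 :: real) \<noteq> 0" by simp
  ultimately have "(\<Sum>j<Suc (2 * m). cos ((2 * real j + 1) * a)) = 0"
    by (simp only: mult_eq_0_iff simp_thms)
  then show ?thesis
    by (simp only: mid lessThan_Suc_atMost atMost_atLeast0)
qed

text \<open>
  The value doubles at \<open>n = k = 2m\<close>, where \<open>sin((2m + 1) \<psi>\<^sub>j) = \<plusminus>1\<close> at all nodes.
\<close>

lemma discrete_sine_orthogonality:
  assumes "k \<le> 2 * m" "n \<le> 2 * m"
  shows "2 / (2 * real m + 1) * (\<Sum>j=0..2*m. sin ((real n + 1) * psi m j) * sin ((real k + 1) * psi m j))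
    = (if n = k then if k = 2 * m then 2 else 1 else 0)"
proof -
  have eq: "sin ((real n + 1) * x) * sin ((real k + 1) * x) =
    (cos (of_int (int n - int k) * x) - cos (of_int (int n + int k + 2) * x)) / 2" for x
    unfolding sin_times_sin by (simp add: algebra_simps)
  have A: "(\<Sum>j=0..2*m. cos (of_int (int n - int k) * psi m j)) = (if n = k then 2 * real m + 1 else 0)"
    using sum_cos_psi_eq_0[of "int n - int k" m] assms by (cases "n = k") auto
  have B: "(\<Sum>j=0..2*m. cos (of_int (int n + int k + 2) * psi m j)) = (if n = 2 * m \<and> k = 2 * m then - (2 * real m + 1) else 0)"
  proof (cases "n = 2 * m \<and> k = 2 * m")
    case True
    have "cos (of_int (int n + int k + 2) * psi m j) = -1" for j
    proof -
      have "of_int (int n + int k + 2) * psi m j = real (2 * j + 1) * pi"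
        using True by (simp add: psi_def field_simps)
      moreover have "cos (real (2 * j + 1) * pi) = -1" unfolding cos_npi by simp
      ultimately show ?thesis by (simp only:)
    qed
    then show ?thesis using True by simp
  next
    case False
    then have "int n + int k + 2 < 4 * int m + 2" using assms by auto
    then show ?thesis using sum_cos_psi_eq_0[of "int n + int k + 2" m] False by auto
  qed
  have "(\<Sum>j=0..2*m. sin ((real n + 1) * psi m j) * sin ((real k + 1) * psi m j))
     = ((if n = k then 2 * real m + 1 else 0) - (if n = 2 * m \<and> k = 2 * m then - (2 * real m + 1) else 0)) / 2"
    unfolding eq sum_divide_distrib[symmetric] sum_subtractf A B ..
  note sum = this
  define N where "N = 2 * real m + 1"
  have "N \<noteq> 0" unfolding N_def by linarith
  then show ?thesis unfolding sum N_def[symmetric] by auto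
qed

text \<open>
  The terms with \<open>n \<le> 2m\<close> reproduce \<open>c k\<close>, except that the top coefficient is doubled, an error of
  at most \<open>C/N\<^sup>4\<close>. The remaining terms alias, but the sampled tail is at most
  \<open>C/N\<^sup>3\<close> and the normalised sum over the nodes at most doubles it.
\<close>

lemma discrete_sine_coeff_error:
  assumes c: "\<And>n. \<bar>c n\<bar> \<le> C / (real n + 1) ^ 4"
    and G: "\<And>j. j \<le> 2 * m \<Longrightarrow> (\<lambda>n. c n * sin ((real n + 1) * psi m j)) sums G j"
    and k: "k \<le> 2 * m"
  shows "\<bar>2 / (2 * real m + 1) * (\<Sum>j=0..2*m. G j * sin ((real k + 1) * psi m j)) - c k\<bar>
    \<le> 3 * C / (2 * real m + 1) ^ 3"
proof -
  define N where "N = Suc (2 * m)"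
  have N: "real N = 2 * real m + 1" "N \<ge> 1" by (simp_all add: N_def)
  have C: "C \<ge> 0" using c[of 0] by simp
  define r where "r = (\<lambda>j. G j - (\<Sum>n<N. c n * sin ((real n + 1) * psi m j)))"
  have r: "\<bar>r j\<bar> \<le> C / real N ^ 3" if "j \<le> 2 * m" for j
  proof -
    have "\<bar>r j\<bar> \<le> (C / (real N)\<^sup>2) / real N"
      unfolding r_def
    proof (rule inverse_square_tail[OF G[OF that] N(2)])
      fix n assume n: "n \<ge> N"
      have "\<bar>c n * sin ((real n + 1) * psi m j)\<bar> \<le> C / (real n + 1) ^ 4 * 1"
        unfolding abs_mult using c C by (intro mult_mono) auto
      also have "\<dots> = C / ((real n + 1)\<^sup>2 * (real n + 1)\<^sup>2)"
        by (simp flip: power_add)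
      also have "\<dots> \<le> C / ((real N)\<^sup>2 * (real n + 1)\<^sup>2)"
        using n N C by (intro divide_left_mono mult_right_mono power_mono) auto
      finally show "\<bar>c n * sin ((real n + 1) * psi m j)\<bar> \<le> C / (real N)\<^sup>2 / (real n + 1)\<^sup>2"
        by simp
    qed (use C in simp)
    then show ?thesis by (simp add: power2_eq_square power3_eq_cube mult.assoc)
  qed
  have main: "2 / real N * (\<Sum>j=0..2*m. (\<Sum>n<N. c n * sin ((real n + 1) * psi m j)) * sin ((real k + 1) * psi m j))
     = c k * (if k = 2 * m then 2 else 1)"
  proof -
    have "2 / real N * (\<Sum>j=0..2*m. (\<Sum>n<N. c n * sin ((real n + 1) * psi m j)) * sin ((real k + 1) * psi m j))
      = (\<Sum>n<N. c n * (2 / real N * (\<Sum>j=0..2*m. sin ((real n + 1) * psi m j) * sin ((real k + 1) * psi m j))))"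
      unfolding sum_distrib_left sum_distrib_right
      by (subst sum.swap, intro sum.cong refl) (simp add: mult_ac)
    also have "\<dots> = (\<Sum>n<N. c n * (if n = k then if k = 2 * m then 2 else 1 else 0))"
    proof (intro sum.cong refl)
      fix n assume "n \<in> {..<N}"
      then have "n \<le> 2 * m" by (simp add: N_def)
      then show "c n * (2 / real N * (\<Sum>j=0..2*m. sin ((real n + 1) * psi m j) * sin ((real k + 1) * psi m j)))
        = c n * (if n = k then if k = 2 * m then 2 else 1 else 0)"
        unfolding N(1) by (simp only: discrete_sine_orthogonality[OF k])
    qed
    also have "\<dots> = (\<Sum>n<N. if n = k then c k * (if k = 2 * m then 2 else 1) else 0)"
      by (intro sum.cong refl) auto
    also have "\<dots> = c k * (if k = 2 * m then 2 else 1)"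
      using k by (simp add: N_def)
    finally show ?thesis .
  qed
  have rem: "\<bar>2 / real N * (\<Sum>j=0..2*m. r j * sin ((real k + 1) * psi m j))\<bar> \<le> 2 * (C / real N ^ 3)"
  proof -
    have "\<bar>\<Sum>j=0..2*m. r j * sin ((real k + 1) * psi m j)\<bar> \<le> (\<Sum>j=0..2*m. C / real N ^ 3 * 1)"
      by (intro order_trans[OF sum_abs] sum_mono, unfold abs_mult) (intro mult_mono r; simp add: C)
    then have "2 / real N * \<bar>\<Sum>j=0..2*m. r j * sin ((real k + 1) * psi m j)\<bar> \<le> 2 / real N * (\<Sum>j=0..2*m. C / real N ^ 3 * 1)"
      by (intro mult_left_mono) auto
    also have "\<dots> = 2 / real N * (real N * (C / real N ^ 3))" by (simp add: N_def)
    also have "\<dots> = 2 * (C / real N ^ 3)" using N(2) by simp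
    finally show ?thesis by (simp add: abs_mult)
  qed
  have dbl: "\<bar>c k * (if k = 2 * m then 2 else 1) - c k\<bar> \<le> C / real N ^ 3"
  proof (cases "k = 2 * m")
    case True
    have "\<bar>c k\<bar> \<le> C / real N ^ 4" using c[of k] True N by simp
    also have "\<dots> \<le> C / real N ^ 3"
      using C N by (intro divide_left_mono power_increasing) auto
    finally show ?thesis using True by simp
  qed (simp add: C)
  have "2 / real N * (\<Sum>j=0..2*m. G j * sin ((real k + 1) * psi m j)) - c k
    = (c k * (if k = 2 * m then 2 else 1) - c k) + 2 / real N * (\<Sum>j=0..2*m. r j * sin ((real k + 1) * psi m j))"
    unfolding main[symmetric] r_def by (simp add: left_diff_distrib sum_subtractf right_diff_distrib)
  also have "\<bar>\<dots>\<bar> \<le> C / real N ^ 3 + 2 * (C / real N ^ 3)"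
    using dbl rem by linarith
  finally show ?thesis by (simp add: N)
qed

lemma abs_sin_diff_le: "\<bar>sin x - sin y\<bar> \<le> \<bar>x - y\<bar>" for x y :: real
proof -
  have "sin x - sin y = 2 * sin ((x - y) / 2) * cos ((x + y) / 2)" by (rule sin_diff_sin)
  then have "\<bar>sin x - sin y\<bar> = 2 * (\<bar>sin ((x - y) / 2)\<bar> * \<bar>cos ((x + y) / 2)\<bar>)"
    by (simp add: abs_mult)
  also have "\<dots> \<le> 2 * (\<bar>(x - y) / 2\<bar> * 1)"
    by (intro mult_left_mono mult_mono abs_sin_x_le_abs_x) auto
  finally show ?thesis by simp
qed

lemma convex_interpolation_error:
  fixes h :: "real \<Rightarrow> real"
  assumes lip: "\<And>x y. \<bar>h x - h y\<bar> \<le> K * \<bar>x - y\<bar>" and "a \<le> \<theta>" "\<theta> \<le> b" "a < b"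
  shows "\<bar>(\<theta> - a) / (b - a) * h b + (1 - (\<theta> - a) / (b - a)) * h a - h \<theta>\<bar> \<le> K * (b - a)"
proof -
  define u where "u = (\<theta> - a) / (b - a)"
  have u: "0 \<le> u" "u \<le> 1" using assms by (simp_all add: u_def divide_le_eq)
  have "0 \<le> K * \<bar>b - a\<bar>" using lip[of b a] by (rule order_trans[OF abs_ge_zero])
  then have K: "0 \<le> K" using \<open>a < b\<close> by (simp add: zero_le_mult_iff)
  have d: "\<bar>h x - h \<theta>\<bar> \<le> K * (b - a)" if "x = a \<or> x = b" for x
    using lip[of x \<theta>] that assms by (elim order_trans) (auto intro!: mult_left_mono K)
  have "u * h b + (1 - u) * h a - h \<theta> = u * (h b - h \<theta>) + (1 - u) * (h a - h \<theta>)"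
    by (simp add: algebra_simps)
  also have "\<bar>\<dots>\<bar> \<le> u * \<bar>h b - h \<theta>\<bar> + (1 - u) * \<bar>h a - h \<theta>\<bar>"
    using u by (intro order_trans[OF abs_triangle_ineq]) (simp add: abs_mult)
  also have "\<dots> \<le> u * (K * (b - a)) + (1 - u) * (K * (b - a))"
    using u d by (intro add_mono mult_left_mono) auto
  finally show ?thesis by (simp add: u_def algebra_simps)
qed

lemma xi_interval:
  assumes "m \<ge> 1" "xi m 0 \<le> \<theta>" "\<theta> \<le> xi m (2 * m - 1)"
  obtains l where "Suc l \<le> 2 * m - 1" "xi m l \<le> \<theta>" "\<theta> \<le> xi m (Suc l)"
proof -
  have "\<exists>l. Suc l \<le> Suc n \<and> xi m l \<le> \<theta> \<and> \<theta> \<le> xi m (Suc l)" if "\<theta> \<le> xi m (Suc n)" for n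
    using that
  proof (induction n)
    case 0 then show ?case using assms(2) by auto
  next
    case (Suc n)
    show ?case
    proof (cases "\<theta> \<le> xi m (Suc n)")
      case True
      then show ?thesis using Suc.IH by (meson le_SucI)
    next
      case False
      then show ?thesis using Suc.prems by (intro exI[of _ "Suc n"]) auto
    qed
  qed
  from this[of "2 * m - 2"] assms that show ?thesis
    by (auto simp: Suc_diff_Suc numeral_2_eq_2)
qed

section \<open>Convergence of the algorithm\<close>

lemma theta_eq: "theta m \<nu> p = arccos (coord (phi m \<nu>) p)"
  by (simp add: theta_def coord_def)

text \<open>
  The comparison goes through the sine polynomial \<open>h\<close> with the coefficients of the algorithm, whose
  interpolant is \<open>ell\<close>. Its Lipschitz constant is \<open>O(1/N)\<close>: the weights of order \<open>k/N\<close> and the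
  factor \<open>k\<close> from differentiation leave \<open>O(k\<^sup>-\<^sup>2/N)\<close> for the decaying part of the coefficients
  and \<open>O(N\<^sup>-\<^sup>2)\<close> for the aliasing error, and both sum to \<open>O(1/N)\<close>. The step of the grid supplies
  the second factor \<open>1/N\<close>. The constant is \<open>10\<close> for the interpolation, using \<open>\<pi> < 4\<close>, and \<open>2\<close> for
  the aliasing.
\<close>

lemma ell_error:
  assumes m: "m \<ge> 1" and \<theta>: "xi m 0 \<le> \<theta>" "\<theta> \<le> xi m (2 * m - 1)"
    and f: "continuous_on disk f"
    and decay: "\<And>n \<phi>. \<bar>radon_coeff f n \<phi>\<bar> \<le> C / (real n + 1) ^ 4"
  shows "\<bar>ell m f \<nu> \<theta> - (\<Sum>k=0..2*m. (real k + 1) / (2 * (2 * real m + 1)) *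
      radon_coeff f k (phi m \<nu>) * sin ((real k + 1) * \<theta>))\<bar> \<le> 12 * C / (2 * real m + 1)\<^sup>2"
proof -
  define N where "N = 2 * real m + 1"
  have N: "N > 0" "N \<ge> 1" by (simp_all add: N_def)
  have C: "C \<ge> 0" using decay[of 0 0] by simp
  define c where "c = (\<lambda>k. radon_coeff f k (phi m \<nu>))"
  define ct where "ct = (\<lambda>k. 2 / N * (\<Sum>j=0..2*m. radon f (phi m \<nu>) (cos (psi m j)) * sin ((real k + 1) * psi m j)))"
  have S: "S_coeff m f k \<nu> = (real k + 1) / (2 * N) * ct k" for k
    using N by (simp add: S_coeff_def ct_def N_def[symmetric] power2_eq_square)
  have err: "\<bar>ct k - c k\<bar> \<le> 3 * C / N ^ 3" if "k \<le> 2 * m" for k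
    unfolding ct_def N_def c_def
  proof (rule discrete_sine_coeff_error[OF decay _ that])
    fix j assume "j \<le> 2 * m"
    from radon_eq_chord_int[OF psi_bounds[OF this], of f "phi m \<nu>"]
    show "(\<lambda>n. radon_coeff f n (phi m \<nu>) * sin ((real n + 1) * psi m j)) sums radon f (phi m \<nu>) (cos (psi m j))"
      using chord_int_sine_series[OF f decay, of "phi m \<nu>" "psi m j"] by simp
  qed
  define h where "h = (\<lambda>\<theta>. \<Sum>k=0..2*m. S_coeff m f k \<nu> * sin ((real k + 1) * \<theta>))"
  have alpha: "alpha m f l \<nu> = h (xi m l)" for l
    by (simp add: alpha_def h_def)
  have kN: "real k + 1 \<le> N" if "k \<le> 2 * m" for k using that by (simp add: N_def)
  have coeff: "(real k + 1) * \<bar>S_coeff m f k \<nu>\<bar> \<le> C / (2 * N) * (1 / (real k + 1)\<^sup>2) + 3 * C / (2 * N\<^sup>2)"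
    if "k \<le> 2 * m" for k
  proof -
    define a where "a = real k + 1"
    have a: "a > 0" "a \<le> N" using kN[OF that] by (simp_all add: a_def)
    have "\<bar>ct k\<bar> \<le> C / a ^ 4 + 3 * C / N ^ 3"
      using err[OF that] decay[of k "phi m \<nu>"] unfolding c_def a_def by linarith
    moreover have "\<bar>S_coeff m f k \<nu>\<bar> = a / (2 * N) * \<bar>ct k\<bar>"
      using a N unfolding S abs_mult a_def[symmetric] by simp
    ultimately have "a * \<bar>S_coeff m f k \<nu>\<bar> \<le> a * (a / (2 * N) * (C / a ^ 4 + 3 * C / N ^ 3))"
      using a N by (simp only:) (intro mult_left_mono; simp)
    also have "\<dots> = C / (2 * N) * (1 / a\<^sup>2) + a\<^sup>2 * (3 * C / (2 * N ^ 4))"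
      using a N by (simp add: power2_eq_square power3_eq_cube power4_eq_xxxx distrib_left)
    also have "a\<^sup>2 * (3 * C / (2 * N ^ 4)) \<le> N\<^sup>2 * (3 * C / (2 * N ^ 4))"
      using a N C by (intro mult_right_mono power_mono) auto
    also have "N\<^sup>2 * (3 * C / (2 * N ^ 4)) = 3 * C / (2 * N\<^sup>2)"
      using N by (simp add: power2_eq_square power4_eq_xxxx)
    finally show ?thesis by (simp add: a_def)
  qed
  have lip: "\<bar>h x - h y\<bar> \<le> 5 * C / (2 * N) * \<bar>x - y\<bar>" for x y
  proof -
    define B where "B = (\<Sum>k=0..2*m. (C / (2 * N) * (1 / (real k + 1)\<^sup>2) + 3 * C / (2 * N\<^sup>2)) * \<bar>x - y\<bar>)"
    have h: "h x - h y = (\<Sum>k=0..2*m. S_coeff m f k \<nu> * (sin ((real k + 1) * x) - sin ((real k + 1) * y)))"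
      by (simp add: h_def sum_subtractf right_diff_distrib)
    have "\<bar>h x - h y\<bar> \<le> B"
      unfolding h B_def
    proof (intro order_trans[OF sum_abs] sum_mono)
      fix k assume "k \<in> {0..2*m}"
      then have k: "k \<le> 2 * m" by simp
      have "\<bar>sin ((real k + 1) * x) - sin ((real k + 1) * y)\<bar> \<le> \<bar>(real k + 1) * x - (real k + 1) * y\<bar>"
        by (rule abs_sin_diff_le)
      also have "\<dots> = (real k + 1) * \<bar>x - y\<bar>" by (simp add: abs_mult flip: right_diff_distrib)
      finally have "\<bar>S_coeff m f k \<nu> * (sin ((real k + 1) * x) - sin ((real k + 1) * y))\<bar>
          \<le> \<bar>S_coeff m f k \<nu>\<bar> * ((real k + 1) * \<bar>x - y\<bar>)"
        unfolding abs_mult by (intro mult_left_mono) auto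
      also have "\<dots> = ((real k + 1) * \<bar>S_coeff m f k \<nu>\<bar>) * \<bar>x - y\<bar>" by (simp add: mult_ac)
      also have "\<dots> \<le> (C / (2 * N) * (1 / (real k + 1)\<^sup>2) + 3 * C / (2 * N\<^sup>2)) * \<bar>x - y\<bar>"
        by (intro mult_right_mono coeff[OF k]) simp
      finally show "\<bar>S_coeff m f k \<nu> * (sin ((real k + 1) * x) - sin ((real k + 1) * y))\<bar>
        \<le> (C / (2 * N) * (1 / (real k + 1)\<^sup>2) + 3 * C / (2 * N\<^sup>2)) * \<bar>x - y\<bar>" .
    qed
    also have "B = (C / (2 * N) * (\<Sum>k=0..2*m. 1 / (real k + 1)\<^sup>2) + N * (3 * C / (2 * N\<^sup>2))) * \<bar>x - y\<bar>"
      by (simp only: B_def sum_distrib_right[symmetric] sum.distrib sum_distrib_left[symmetric])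
         (simp add: N_def)
    also have "\<dots> \<le> (C / (2 * N) * 2 + N * (3 * C / (2 * N\<^sup>2))) * \<bar>x - y\<bar>"
      using C N sum_inverse_squares_le by (intro mult_right_mono add_right_mono mult_left_mono) auto
    also have "\<dots> = 5 * C / (2 * N) * \<bar>x - y\<bar>"
      using N by (simp add: power2_eq_square add_divide_distrib[symmetric])
    finally show ?thesis .
  qed
  obtain l where l: "Suc l \<le> 2 * m - 1" "xi m l \<le> \<theta>" "\<theta> \<le> xi m (Suc l)"
    using xi_interval[OF m \<theta>] .
  have step: "xi m (Suc l) - xi m l = pi / N"
    unfolding xi_def N_def diff_divide_distrib[symmetric] by (simp add: algebra_simps)
  have "\<bar>ell m f \<nu> \<theta> - h \<theta>\<bar> \<le> 5 * C / (2 * N) * (xi m (Suc l) - xi m l)"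
    unfolding ell_eq[OF l] alpha
    by (rule convex_interpolation_error[OF lip l(2,3)]) (simp add: xi_less_iff)
  also have "\<dots> = 5 * C / (2 * N) * (pi / N)" unfolding step ..
  also have "\<dots> \<le> 5 * C / (2 * N) * (4 / N)"
    using C N pi_less_4 by (intro mult_left_mono divide_right_mono) auto
  finally have interp: "\<bar>ell m f \<nu> \<theta> - h \<theta>\<bar> \<le> 10 * C / N\<^sup>2"
    by (simp add: power2_eq_square)
  have "\<bar>h \<theta> - (\<Sum>k=0..2*m. (real k + 1) / (2 * N) * c k * sin ((real k + 1) * \<theta>))\<bar>
    = \<bar>\<Sum>k=0..2*m. (real k + 1) / (2 * N) * (ct k - c k) * sin ((real k + 1) * \<theta>)\<bar>"
    by (simp add: h_def S sum_subtractf right_diff_distrib left_diff_distrib)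
  also have "\<dots> \<le> (\<Sum>k=0..2*m. N / (2 * N) * (3 * C / N ^ 3) * 1)"
  proof (intro order_trans[OF sum_abs] sum_mono)
    fix k assume "k \<in> {0..2*m}"
    then have k: "k \<le> 2 * m" by simp
    show "\<bar>(real k + 1) / (2 * N) * (ct k - c k) * sin ((real k + 1) * \<theta>)\<bar> \<le> N / (2 * N) * (3 * C / N ^ 3) * 1"
      unfolding abs_mult using kN[OF k] N C
      by (intro mult_mono err[OF k]) (auto intro!: divide_right_mono)
  qed
  also have "\<dots> = N * (N / (2 * N) * (3 * C / N ^ 3))" by (simp add: N_def)
  also have "\<dots> = 3 / 2 * C / N\<^sup>2" using N by (simp add: power2_eq_square power3_eq_cube)
  also have "\<dots> \<le> 2 * C / N\<^sup>2" using C by (intro divide_right_mono) auto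
  finally have aliasing: "\<bar>h \<theta> - (\<Sum>k=0..2*m. (real k + 1) / (2 * N) * c k * sin ((real k + 1) * \<theta>))\<bar> \<le> 2 * C / N\<^sup>2" .
  have "10 * C / N\<^sup>2 + 2 * C / N\<^sup>2 = 12 * C / N\<^sup>2" by (simp add: add_divide_distrib[symmetric])
  with interp aliasing show ?thesis unfolding N_def[symmetric] c_def by linarith
qed

text \<open>
  The quotient \<open>sin((k + 1) \<theta>)/sin \<theta>\<close> is \<open>U\<^sub>k(cos \<theta>)\<close>, so with exact coefficients and without
  interpolation the algorithm computes the partial sum of \<open>radon_expansion\<close> of degree \<open>2m\<close>.
\<close>

lemma oped_interp_error:
  assumes m: "m \<ge> 1" and p: "p \<in> Omega m" "p \<in> disk"
    and \<delta>: "\<delta> > 0" "\<And>\<phi>. \<delta> \<le> sqrt (1 - (coord \<phi> p)\<^sup>2)"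
    and f: "continuous_on disk f"
    and decay: "\<And>n \<phi>. \<bar>radon_coeff f n \<phi>\<bar> \<le> C / (real n + 1) ^ 4"
  shows "\<bar>oped_interp m f p - f p\<bar> \<le> (12 * C / \<delta> + C / 2) / (2 * real m + 1)"
proof -
  define N where "N = 2 * real m + 1"
  have N: "N > 0" by (simp add: N_def)
  have C: "C \<ge> 0" using decay[of 0 0] by simp
  let ?\<theta> = "\<lambda>\<nu>. theta m \<nu> p"
  have co: "\<bar>coord \<phi> p\<bar> \<le> 1" for \<phi> using p(2) by (rule abs_coord_le_1)
  have cos: "cos (?\<theta> \<nu>) = coord (phi m \<nu>) p" for \<nu>
    using co by (simp add: theta_eq cos_arccos_abs)
  have sin: "\<delta> \<le> sin (?\<theta> \<nu>)" for \<nu>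
    using co[of "phi m \<nu>"] \<delta>(2)[of "phi m \<nu>"] by (simp add: theta_eq sin_arccos abs_le_iff)
  define T where "T = (\<lambda>\<nu>. \<Sum>k=0..2*m. (real k + 1) / (2 * N) * radon_coeff f k (phi m \<nu>) * sin ((real k + 1) * ?\<theta> \<nu>))"
  have "\<bar>oped_interp m f p - (\<Sum>\<nu>=0..2*m. 1 / sin (?\<theta> \<nu>) * T \<nu>)\<bar>
    = \<bar>\<Sum>\<nu>=0..2*m. 1 / sin (?\<theta> \<nu>) * (ell m f \<nu> (?\<theta> \<nu>) - T \<nu>)\<bar>"
    by (simp add: oped_interp_def sum_subtractf right_diff_distrib)
  also have "\<dots> \<le> (\<Sum>\<nu>=0..2*m. 1 / \<delta> * (12 * C / N\<^sup>2))"
  proof (intro order_trans[OF sum_abs] sum_mono)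
    fix \<nu>
    have s: "sin (?\<theta> \<nu>) > 0" using sin[of \<nu>] \<delta>(1) by linarith
    have "\<bar>1 / sin (?\<theta> \<nu>)\<bar> \<le> 1 / \<delta>" using sin[of \<nu>] \<delta>(1) s by (simp add: frac_le)
    moreover have "\<bar>ell m f \<nu> (?\<theta> \<nu>) - T \<nu>\<bar> \<le> 12 * C / N\<^sup>2"
      using theta_mem_Omega[OF m p(1), of \<nu>] unfolding T_def N_def
      by (intro ell_error[OF m _ _ f decay]) auto
    ultimately show "\<bar>1 / sin (?\<theta> \<nu>) * (ell m f \<nu> (?\<theta> \<nu>) - T \<nu>)\<bar> \<le> 1 / \<delta> * (12 * C / N\<^sup>2)"
      unfolding abs_mult using \<delta>(1) by (intro mult_mono) auto
  qed
  also have "\<dots> = N * (1 / \<delta> * (12 * C / N\<^sup>2))" by (simp add: N_def)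
  also have "\<dots> = 12 * C / \<delta> / N" using N by (simp add: power2_eq_square)
  finally have 1: "\<bar>oped_interp m f p - (\<Sum>\<nu>=0..2*m. 1 / sin (?\<theta> \<nu>) * T \<nu>)\<bar> \<le> 12 * C / \<delta> / N" .
  have "(\<Sum>\<nu>=0..2*m. 1 / sin (?\<theta> \<nu>) * T \<nu>)
    = (\<Sum>\<nu>=0..2*m. \<Sum>k=0..2*m. (real k + 1) / (2 * N) * (radon_coeff f k (phi m \<nu>) * cheb_U k (coord (phi m \<nu>) p)))"
    unfolding T_def sum_distrib_left
  proof (intro sum.cong refl)
    fix \<nu> k
    have "sin (?\<theta> \<nu>) \<noteq> 0" using sin[of \<nu>] \<delta>(1) by auto
    then show "1 / sin (?\<theta> \<nu>) * ((real k + 1) / (2 * N) * radon_coeff f k (phi m \<nu>) * sin ((real k + 1) * ?\<theta> \<nu>))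
      = (real k + 1) / (2 * N) * (radon_coeff f k (phi m \<nu>) * cheb_U k (coord (phi m \<nu>) p))"
      unfolding sin_mult_cheb_U[symmetric] cos by simp
  qed
  also have "\<dots> = (\<Sum>k=0..2*m. radon_proj f k p)"
    by (subst sum.swap, intro sum.cong refl)
       (simp add: radon_proj_discrete[OF f, of _ m] N_def sum_distrib_left)
  also have "\<dots> = (\<Sum>k<Suc (2*m). radon_proj f k p)"
    by (simp only: lessThan_Suc_atMost atMost_atLeast0)
  finally have 2: "(\<Sum>\<nu>=0..2*m. 1 / sin (?\<theta> \<nu>) * T \<nu>) = (\<Sum>k<Suc (2*m). radon_proj f k p)" .
  have "\<bar>f p - (\<Sum>k<Suc (2*m). radon_proj f k p)\<bar> \<le> (C / 2) / real (Suc (2 * m))"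
  proof (rule inverse_square_tail)
    show "(\<lambda>n. radon_proj f n p) sums f p"
      using tendsto_uniform_limitI[OF radon_expansion[OF f decay] p(2)] by (simp add: sums_def)
    fix n
    show "\<bar>radon_proj f n p\<bar> \<le> C / 2 / (real n + 1)\<^sup>2"
      using abs_radon_proj_le[OF decay p(2), of n]
      by (simp add: power2_eq_square power4_eq_xxxx)
  qed (use C in auto)
  then have 3: "\<bar>f p - (\<Sum>k<Suc (2*m). radon_proj f k p)\<bar> \<le> C / 2 / N" by (simp add: N_def add.commute)
  have "(12 * C / \<delta> + C / 2) / N = 12 * C / \<delta> / N + C / 2 / N" by (rule add_divide_distrib)
  with 1 3 show ?thesis unfolding 2 N_def[symmetric] by linarith
qed

lemma compact_in_open_disk_radius:
  assumes "compact \<Omega>" "\<Omega> \<subseteq> open_disk"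
  obtains r where "0 \<le> r" "r < 1" "\<And>p. p \<in> \<Omega> \<Longrightarrow> (fst p)\<^sup>2 + (snd p)\<^sup>2 \<le> r"
proof (cases "\<Omega> = {}")
  case False
  have "continuous_on \<Omega> (\<lambda>p. (fst p)\<^sup>2 + (snd p)\<^sup>2)" by (intro continuous_intros)
  from continuous_attains_sup[OF assms(1) False this] obtain q
    where q: "q \<in> \<Omega>" "\<And>p. p \<in> \<Omega> \<Longrightarrow> (fst p)\<^sup>2 + (snd p)\<^sup>2 \<le> (fst q)\<^sup>2 + (snd q)\<^sup>2" by blast
  have "(fst q)\<^sup>2 + (snd q)\<^sup>2 < 1"
    using q(1) assms(2) by (auto simp: open_disk_def)
  then show ?thesis using q(2) by (intro that[of "(fst q)\<^sup>2 + (snd q)\<^sup>2"]) auto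
qed (use that[of 0] in auto)

text \<open>
  If \<open>\<Omega>\<close> lies in the disk of radius \<open>sqrt r\<close> with \<open>r < 1\<close>, then \<open>sin \<theta>\<^sub>\<nu> \<ge> sqrt (1 - r)\<close> for all
  angles, which is the lower bound \<open>\<delta>\<close> of \<open>oped_interp_error\<close>.
\<close>

theorem oped_interp_linear_rate:
  assumes "C_disk 4 f" "compact \<Omega>" "\<Omega> \<subseteq> open_disk"
  obtains K where "K \<ge> 0"
    "\<And>m p. m \<ge> 1 \<Longrightarrow> \<Omega> \<subseteq> Omega m \<Longrightarrow> p \<in> \<Omega> \<Longrightarrow> \<bar>oped_interp m f p - f p\<bar> \<le> K / (2 * real m + 1)"
proof -
  obtain C where C: "C \<ge> 0" "\<And>n \<phi>. \<bar>radon_coeff f n \<phi>\<bar> \<le> C / (real n + 1) ^ 4"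
    using C_disk_radon_coeff_decay[OF assms(1)] by blast
  obtain r where r: "0 \<le> r" "r < 1" "\<And>p. p \<in> \<Omega> \<Longrightarrow> (fst p)\<^sup>2 + (snd p)\<^sup>2 \<le> r"
    using compact_in_open_disk_radius[OF assms(2,3)] by blast
  define \<delta> where "\<delta> = sqrt (1 - r)"
  have \<delta>: "\<delta> > 0" using r by (simp add: \<delta>_def)
  have "\<bar>oped_interp m f p - f p\<bar> \<le> (12 * C / \<delta> + C / 2) / (2 * real m + 1)"
    if "m \<ge> 1" "\<Omega> \<subseteq> Omega m" "p \<in> \<Omega>" for m p
  proof (rule oped_interp_error[OF that(1) _ _ \<delta> _ C_disk_imp_continuous[OF assms(1)] C(2)])
    show "p \<in> Omega m" "p \<in> disk" using that assms(3) open_disk_subset by auto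
    fix \<phi>
    have "(coord \<phi> p)\<^sup>2 \<le> (sqrt ((fst p)\<^sup>2 + (snd p)\<^sup>2))\<^sup>2"
      using abs_coord_le[of \<phi> p] by (intro power2_le_iff_abs_le[THEN iffD2]) auto
    also have "\<dots> \<le> r" using r(3)[OF that(3)] by simp
    finally show "\<delta> \<le> sqrt (1 - (coord \<phi> p)\<^sup>2)" by (simp add: \<delta>_def)
  qed
  moreover have "12 * C / \<delta> + C / 2 \<ge> 0" using C \<delta> by simp
  ultimately show ?thesis by (intro that)
qed

lemma eventually_subset_Omega:
  assumes "compact \<Omega>" "\<Omega> \<subseteq> open_disk"
  shows "\<forall>\<^sub>F m in sequentially. \<Omega> \<subseteq> Omega m"
proof -
  obtain r where r: "0 \<le> r" "r < 1" "\<And>p. p \<in> \<Omega> \<Longrightarrow> (fst p)\<^sup>2 + (snd p)\<^sup>2 \<le> r"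
    using compact_in_open_disk_radius[OF assms] by blast
  have "(\<lambda>m. inverse (real (Suc (2 * m)))) \<longlonglongrightarrow> 0"
    using LIMSEQ_subseq_LIMSEQ[OF LIMSEQ_inverse_real_of_nat, of "\<lambda>m. 2 * m"]
    by (simp add: strict_mono_def o_def)
  then have "(\<lambda>m. cos (pi * inverse (real (Suc (2 * m))))) \<longlonglongrightarrow> cos (pi * 0)"
    by (intro tendsto_intros)
  moreover have "sqrt r < cos (pi * 0)" using r by simp
  ultimately have "\<forall>\<^sub>F m in sequentially. sqrt r < cos (pi * inverse (real (Suc (2 * m))))"
    by (rule order_tendstoD)
  then show ?thesis
  proof eventually_elim
    case (elim m)
    then have "sqrt r \<le> cos (pi / (2 * real m + 1))" by (simp add: divide_inverse add.commute)
    show ?case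
    proof
      fix p assume "p \<in> \<Omega>"
      then have "sqrt ((fst p)\<^sup>2 + (snd p)\<^sup>2) \<le> sqrt r"
        by (intro real_sqrt_le_mono r(3))
      also have "\<dots> \<le> cos (pi / (2 * real m + 1))" by fact
      finally show "p \<in> Omega m"
        by (simp add: Omega_def case_prod_beta)
    qed
  qed
qed

theorem theorem3p5:
  fixes f :: "real \<times> real \<Rightarrow> real" and \<Omega> :: "(real \<times> real) set"
  assumes "C_disk 4 f"
    and "compact \<Omega>" and "\<Omega> \<subseteq> open_disk"
  shows "(\<exists>c::real. \<forall>m::nat. m \<ge> 1 \<longrightarrow> \<Omega> \<subseteq> Omega m \<longrightarrow>
            (\<forall>p\<in>\<Omega>. \<bar>oped_interp m f p - f p\<bar> \<le> c * (ln (real m + 1) / sqrt (real m))))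
       \<and> uniform_limit \<Omega> (\<lambda>m. oped_interp m f) f sequentially"
proof
  obtain K where K: "K \<ge> 0"
    "\<And>m p. m \<ge> 1 \<Longrightarrow> \<Omega> \<subseteq> Omega m \<Longrightarrow> p \<in> \<Omega> \<Longrightarrow> \<bar>oped_interp m f p - f p\<bar> \<le> K / (2 * real m + 1)"
    using oped_interp_linear_rate[OF assms] by blast
  have rate: "K / (2 * real m + 1) \<le> K / ln 2 * (ln (real m + 1) / sqrt (real m))" if "m \<ge> 1" for m
  proof -
    have "sqrt (real m) \<le> real m" using that by (intro real_le_lsqrt self_le_power) auto
    then have s: "sqrt (real m) \<le> 2 * real m + 1" "sqrt (real m) > 0" using that by simp_all
    have l: "ln 2 \<le> ln (real m + 1)" using that by simp
    have "1 / (2 * real m + 1) \<le> 1 / sqrt (real m)" using s by (intro divide_left_mono) auto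
    also have "\<dots> \<le> (ln (real m + 1) / ln 2) / sqrt (real m)"
      using l s by (intro divide_right_mono) (auto simp: le_divide_eq)
    finally have "K * (1 / (2 * real m + 1)) \<le> K * ((ln (real m + 1) / ln 2) / sqrt (real m))"
      using K(1) by (rule mult_left_mono)
    then show ?thesis by simp
  qed
  show "\<exists>c::real. \<forall>m::nat. m \<ge> 1 \<longrightarrow> \<Omega> \<subseteq> Omega m \<longrightarrow>
            (\<forall>p\<in>\<Omega>. \<bar>oped_interp m f p - f p\<bar> \<le> c * (ln (real m + 1) / sqrt (real m)))"
    using K(2) rate by (intro exI[of _ "K / ln 2"]) (blast intro: order_trans)
  show "uniform_limit \<Omega> (\<lambda>m. oped_interp m f) f sequentially"
  proof (rule uniform_limitI)
    fix e :: real assume "e > 0"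
    have "(\<lambda>m. K * inverse (real (Suc m))) \<longlonglongrightarrow> K * 0"
      by (intro tendsto_intros LIMSEQ_inverse_real_of_nat)
    then have "\<forall>\<^sub>F m in sequentially. K * inverse (real (Suc m)) < e"
      using \<open>e > 0\<close> by (intro order_tendstoD(2)) auto
    then show "\<forall>\<^sub>F m in sequentially. \<forall>p\<in>\<Omega>. dist (oped_interp m f p) (f p) < e"
      using eventually_subset_Omega[OF assms(2,3)] eventually_ge_at_top[of 1]
    proof eventually_elim
      case (elim m)
      have "K / (2 * real m + 1) \<le> K / real (Suc m)" using K(1) by (intro divide_left_mono) auto
      then have "K / (2 * real m + 1) < e" using elim(1) by (simp add: divide_inverse)
      then show ?case using K(2)[OF elim(3,2)] by (auto simp: dist_real_def intro: le_less_trans)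
    qed
  qed
qed

end
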